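(* Let $N\ge1$ and let $\zeta_{\mathcal{A}(N),\sqcup\!\sqcup}:=\zeta_{\mathcal{A}(N),\ast}\circ\mathbf{q}\colon\mathfrak{A}_N^1\to\mathcal{A}(N)$. Then for all $u\in\mathfrak{A}_1^1$ and $v\in\mathfrak{A}_N^1$, $$\zeta_{\mathcal{A}(N),\sqcup\!\sqcup}(u\sqcup\!\sqcup v)=\zeta_{\mathcal{A}(N),\sqcup\!\sqcup}(\tau(u)v),$$ where $\tau(u)v$ is the concatenation product.
   Context: Fix $N\ge1$. $\Gamma_N\subset\mathbb{C}$ is the group of $N$th roots of unity, $\xi_N\in\Gamma_N$ a fixed primitive one, $K=\mathbb{Q}(\Gamma_N)=\mathbb{Q}(\xi_N)$. The ring $\mathcal{A}(N)$: let $\mathcal{P}(N)$ be the set of primes $p$ with $p\equiv -1 \pmod N$. For each $p\in\mathcal{P}(N)$ fix a primitive $N$th root of unity $\xi_{N,p}$ in an algebraic closure of $\mathbb{F}_p$ and let $\mathbb{F}_p[\xi_N]:=\{\sum_{j=0}^{N-1}c_j\xi_{N,p}^j: c_j\in\mathbb{F}_p\}$. Put $\mathcal{A}(N):=\prod_{p\in\mathcal{P}(N)}\mathbb{F}_p[\xi_N]\big/\bigoplus_{p\in\mathcal{P}(N)}\mathbb{F}_p[\xi_N]$. It is a $K$-algebra via the embedding sending $\sum_{j=0}^{N-1} a_j\xi_N^j$ ($a_j\in\mathbb{Q}$) to the class of $(\sum_j \phi_p(a_j)\xi_{N,p}^j)_p$, where $\phi_p(a)=a \bmod p$ if $\mathrm{ord}_p(a)\ge0$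 (or $a=0$) and $\phi_p(a)=0$ otherwise. Finite colored multiple zeta values: for $\mathbf{s}\in\mathbb{N}^d$ ($\mathbb{N}$ = positive integers) and $\boldsymbol\eta\in\Gamma_N^d$, $$\zeta_{\mathcal{A}(N)}\binom{\mathbf{s}}{\boldsymbol\eta}:=\Big(\sum_{p>k_1>\cdots>k_d>0}\frac{\eta_1^{k_1}\cdots\eta_d^{k_d}}{k_1^{s_1}\cdots k_d^{s_d}}\Big)_{p\in\mathcal{P}(N)}\in\mathcal{A}(N),$$ where in the $p$-component $\eta_j=\xi_N^{e_j}$ is read as $\xi_{N,p}^{e_j}$. Words: $\mathfrak{A}_N$ is the free noncommutative polynomial algebra over $K$ on the letters $x_\eta$, $\eta\in\Gamma_N\cup\{0\}$; $1$ is the empty word. $\mathfrak{A}_N^1\subset\mathfrak{A}_N$ is the subalgebra spanned by the words not ending in $x_0$; it is freely generated by $y_{m,\mu}:=x_0^{m-1}x_\mu$ ($m\in\mathbb{N}$, $\mu\in\Gamma_N$). $\mathfrak{A}_1^1\subset\mathfrak{A}_N^1$ is the span of those words in $x_0,x_1$ only that do not end in $x_0$. The shuffle product $\sqcup\!\sqcup$ on $\mathfrak{A}_N$ is the bilinear product with $1\sqcup\!\sqcup w=w\sqcup\!\sqcup1=w$ and $au\sqcup\!\sqcup bv=a(u\sqcup\!\sqcup bv)+b(au\sqcup\!\sqcup v)$ for letters $a,b$ and words $u,v,w$. Linear maps (all $K$-linear): $\zeta_{\mathcal{A}(N),\ast}\colon\mathfrak{A}_N^1\to\mathcal{A}(N)$,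 $y_{s_1,\eta_1}\cdots y_{s_d,\eta_d}\mapsto\zeta_{\mathcal{A}(N)}\binom{s_1,\dots,s_d}{\eta_1,\dots,\eta_d}$, $1\mapsto1$; $\mathbf{q}\colon\mathfrak{A}_N^1\to\mathfrak{A}_N^1$, $\mathbf{q}(y_{s_1,\eta_1}y_{s_2,\eta_2}\cdots y_{s_d,\eta_d})=y_{s_1,\eta_1}y_{s_2,\eta_2\eta_1^{-1}}\cdots y_{s_d,\eta_d\eta_{d-1}^{-1}}$; $\tau\colon\mathfrak{A}_1^1\to\mathfrak{A}_1^1$, $\tau(1)=1$, $\tau(x_0^{s_1-1}x_1\cdots x_0^{s_d-1}x_1)=(-1)^{s_1+\cdots+s_d}x_0^{s_d-1}x_1\cdots x_0^{s_1-1}x_1$. *)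

theory Defs
  imports
    Complex_Main
    "HOL-Library.Poly_Mapping"
    "HOL-Number_Theory.Number_Theory"
    "HOL-Algebra.Algebra"
    "HOL-Algebra.Algebraic_Closure_Type"
begin

section \<open>Roots of unity\<close>

definition primitive_unity_root :: "('a, 'b) ring_scheme \<Rightarrow> nat \<Rightarrow> 'a \<Rightarrow> bool" where
  "primitive_unity_root R N x \<longleftrightarrow>
     x \<in> carrier R \<and> x [^]\<^bsub>R\<^esub> N = \<one>\<^bsub>R\<^esub> \<and> (\<forall>k. 0 < k \<and> k < N \<longrightarrow> x [^]\<^bsub>R\<^esub> k \<noteq> \<one>\<^bsub>R\<^esub>)"

abbreviation complex_ring :: "complex ring" where
  "complex_ring \<equiv> ring_of_type_algebra"

definition Gamma :: "nat \<Rightarrow> complex set" where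
  "Gamma N = {z. z ^ N = 1}"

definition cyclotomic_field :: "nat \<Rightarrow> complex set" where
  "cyclotomic_field N = generate_field complex_ring (Gamma N)"


section \<open>The ring A(N)\<close>

definition primes_minus1 :: "nat \<Rightarrow> nat set" where
  "primes_minus1 N = {p. Factorial_Ring.prime p \<and> [int p = -1] (mod int N)}"

text \<open>
  The prime field is embedded in \<open>L\<close> by the (unique) homomorphism \<open>c \<mapsto> c \<cdot> 1\<close>; below,
  the elements of the prime field are accordingly written \<open>[c] \<cdot> \<one>\<close>.
\<close>

definition alg_closure_of_prime_field :: "nat \<Rightarrow> 'a ring \<Rightarrow> bool" where
  "alg_closure_of_prime_field p L \<longleftrightarrow>
     (\<exists>h \<in> ring_hom (residue_ring (int p)) L.
        algebraic_closure L (h ` carrier (residue_ring (int p))))"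

lemma alg_closure_of_prime_field_exists:
  assumes "Factorial_Ring.prime p"
  shows "\<exists>L :: ((int list \<times> nat) multiset \<Rightarrow> int) ring. alg_closure_of_prime_field p L"
proof -
  interpret residues_prime p "residue_ring (int p)"
    using assms by unfold_locales auto
  interpret field "residue_ring (int p)"
    by (rule is_field)
  show ?thesis
    unfolding alg_closure_of_prime_field_def using alg_closureE by blast
qed

definition prime_field_adjoin :: "'a ring \<Rightarrow> nat \<Rightarrow> 'a \<Rightarrow> 'a ring" where
  "prime_field_adjoin L N x =
     L\<lparr>carrier := {\<Oplus>\<^bsub>L\<^esub>j\<in>{..<N}. ([c j] \<cdot>\<^bsub>L\<^esub> \<one>\<^bsub>L\<^esub>) \<otimes>\<^bsub>L\<^esub> (x [^]\<^bsub>L\<^esub> j) | c :: nat \<Rightarrow> int. True}\<rparr>"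

definition product_ring :: "'i set \<Rightarrow> ('i \<Rightarrow> ('a, 'b) ring_scheme) \<Rightarrow> ('i \<Rightarrow> 'a) ring" where
  "product_ring I R =
     \<lparr>carrier = (\<Pi>\<^sub>E i\<in>I. carrier (R i)),
      monoid.mult = (\<lambda>f g. \<lambda>i\<in>I. f i \<otimes>\<^bsub>R i\<^esub> g i),
      one = (\<lambda>i\<in>I. \<one>\<^bsub>R i\<^esub>),
      ring.zero = (\<lambda>i\<in>I. \<zero>\<^bsub>R i\<^esub>),
      add = (\<lambda>f g. \<lambda>i\<in>I. f i \<oplus>\<^bsub>R i\<^esub> g i)\<rparr>"

definition direct_sum :: "'i set \<Rightarrow> ('i \<Rightarrow> ('a, 'b) ring_scheme) \<Rightarrow> ('i \<Rightarrow> 'a) set" where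
  "direct_sum I R = {f \<in> carrier (product_ring I R). finite {i\<in>I. f i \<noteq> \<zero>\<^bsub>R i\<^esub>}}"

text \<open>
  In this section and the last one, \<open>L p\<close> is the chosen algebraic closure of the field with \<open>p\<close>
  elements, \<open>x p\<close> the chosen primitive \<open>N\<close>th root of unity in it, and \<open>\<xi>\<close> the one in the complex
  numbers.
\<close>

definition A_prod :: "nat \<Rightarrow> (nat \<Rightarrow> 'a ring) \<Rightarrow> (nat \<Rightarrow> 'a) \<Rightarrow> (nat \<Rightarrow> 'a) ring" where
  "A_prod N L x = product_ring (primes_minus1 N) (\<lambda>p. prime_field_adjoin (L p) N (x p))"

definition A_ideal :: "nat \<Rightarrow> (nat \<Rightarrow> 'a ring) \<Rightarrow> (nat \<Rightarrow> 'a) \<Rightarrow> (nat \<Rightarrow> 'a) set" where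
  "A_ideal N L x = direct_sum (primes_minus1 N) (\<lambda>p. prime_field_adjoin (L p) N (x p))"

definition A_ring :: "nat \<Rightarrow> (nat \<Rightarrow> 'a ring) \<Rightarrow> (nat \<Rightarrow> 'a) \<Rightarrow> (nat \<Rightarrow> 'a) set ring" where
  "A_ring N L x = A_prod N L x Quot A_ideal N L x"

definition A_class ::
  "nat \<Rightarrow> (nat \<Rightarrow> 'a ring) \<Rightarrow> (nat \<Rightarrow> 'a) \<Rightarrow> (nat \<Rightarrow> 'a) \<Rightarrow> (nat \<Rightarrow> 'a) set" where
  "A_class N L x f = A_ideal N L x +>\<^bsub>A_prod N L x\<^esub> (\<lambda>p\<in>primes_minus1 N. f p)"

text \<open>
  \<^const>\<open>quotient_of\<close> yields lowest terms, so \<open>p\<close> divides the denominator iff the \<open>p\<close>-adic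
  valuation is negative.
\<close>

definition rat_mod :: "'a ring \<Rightarrow> nat \<Rightarrow> rat \<Rightarrow> 'a" where
  "rat_mod L p a =
     (let (n, d) = quotient_of a in
      if int p dvd d then \<zero>\<^bsub>L\<^esub>
      else ([n] \<cdot>\<^bsub>L\<^esub> \<one>\<^bsub>L\<^esub>) \<otimes>\<^bsub>L\<^esub> inv\<^bsub>L\<^esub> ([d] \<cdot>\<^bsub>L\<^esub> \<one>\<^bsub>L\<^esub>))"

text \<open>
  The structure map from the cyclotomic field to A(N).  The class does not depend on the chosen
  representation of \<open>z\<close> as a rational combination of powers of \<open>\<xi>\<close>, by irreducibility of the
  cyclotomic polynomial; the definite description relies on this.
\<close>

definition A_embed ::
  "nat \<Rightarrow> complex \<Rightarrow> (nat \<Rightarrow> 'a ring) \<Rightarrow> (nat \<Rightarrow> 'a) \<Rightarrow> complex \<Rightarrow> (nat \<Rightarrow> 'a) set" where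
  "A_embed N \<xi> L x z =
     (THE c. \<exists>a :: nat \<Rightarrow> rat.
        z = (\<Sum>j<N. of_rat (a j) * \<xi> ^ j) \<and>
        c = A_class N L x
              (\<lambda>p. \<Oplus>\<^bsub>L p\<^esub>j\<in>{..<N}. rat_mod (L p) p (a j) \<otimes>\<^bsub>L p\<^esub> (x p [^]\<^bsub>L p\<^esub> j)))"


section \<open>Words\<close>

text \<open>
  The letter \<open>x\<^sub>\<eta>\<close> is represented by the complex number \<open>\<eta>\<close> itself, a word by the list of its
  letters, and a noncommutative polynomial by its finitely supported coefficient function.
\<close>

type_synonym ncpoly = "complex list \<Rightarrow>\<^sub>0 complex"

definition lin_ext :: "('w \<Rightarrow> ('v \<Rightarrow>\<^sub>0 complex)) \<Rightarrow> ('w \<Rightarrow>\<^sub>0 complex) \<Rightarrow> ('v \<Rightarrow>\<^sub>0 complex)" where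
  "lin_ext f u =
     (\<Sum>w\<in>Poly_Mapping.keys u. Poly_Mapping.map ((*) (Poly_Mapping.lookup u w)) (f w))"

definition bilin_ext ::
  "('w \<Rightarrow> 'w \<Rightarrow> ('v \<Rightarrow>\<^sub>0 complex)) \<Rightarrow> ('w \<Rightarrow>\<^sub>0 complex) \<Rightarrow> ('w \<Rightarrow>\<^sub>0 complex) \<Rightarrow> ('v \<Rightarrow>\<^sub>0 complex)" where
  "bilin_ext f u v = lin_ext (\<lambda>a. lin_ext (\<lambda>b. f a b) v) u"

definition conc :: "ncpoly \<Rightarrow> ncpoly \<Rightarrow> ncpoly" where
  "conc = bilin_ext (\<lambda>a b. Poly_Mapping.single (a @ b) 1)"

fun shuffle_words :: "complex list \<Rightarrow> complex list \<Rightarrow> ncpoly" where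
  "shuffle_words [] w = Poly_Mapping.single w 1"
| "shuffle_words w [] = Poly_Mapping.single w 1"
| "shuffle_words (a # u) (b # v) =
     conc (Poly_Mapping.single [a] 1) (shuffle_words u (b # v))
   + conc (Poly_Mapping.single [b] 1) (shuffle_words (a # u) v)"

definition shuffle :: "ncpoly \<Rightarrow> ncpoly \<Rightarrow> ncpoly" where
  "shuffle = bilin_ext shuffle_words"

definition word_span :: "nat \<Rightarrow> complex list set \<Rightarrow> ncpoly set" where
  "word_span N W = {u. Poly_Mapping.keys u \<subseteq> W \<and> (\<forall>w. Poly_Mapping.lookup u w \<in> cyclotomic_field N)}"

definition words1 :: "complex set \<Rightarrow> complex list set" where
  "words1 S = {w \<in> lists S. w = [] \<or> last w \<noteq> 0}"

definition words_alg1 :: "nat \<Rightarrow> ncpoly set" where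
  "words_alg1 N = word_span N (words1 (insert 0 (Gamma N)))"

text \<open>The scalars are those of the level \<open>N\<close> algebra: only the letters are restricted.\<close>

definition words_alg1_level1 :: "nat \<Rightarrow> ncpoly set" where
  "words_alg1_level1 N = word_span N (words1 {0, 1})"

text \<open>
  \<open>y_word [(s\<^sub>1,\<eta>\<^sub>1),\<dots>,(s\<^sub>d,\<eta>\<^sub>d)]\<close> is the word \<open>y\<^bsub>s\<^sub>1,\<eta>\<^sub>1\<^esub>\<cdots>y\<^bsub>s\<^sub>d,\<eta>\<^sub>d\<^esub>\<close>.
\<close>

definition y_word :: "(nat \<times> complex) list \<Rightarrow> complex list" where
  "y_word ys = concat (map (\<lambda>(m, \<mu>). replicate (m - 1) 0 @ [\<mu>]) ys)"

definition y_factors :: "nat \<Rightarrow> complex list \<Rightarrow> (nat \<times> complex) list" where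
  "y_factors N = inv_into (lists ({1..} \<times> Gamma N)) y_word"

lemma y_word_Nil [simp]: "y_word [] = []"
  by (simp add: y_word_def)

lemma y_word_Cons [simp]: "y_word ((m, \<mu>) # ys) = replicate (m - 1) 0 @ \<mu> # y_word ys"
  by (simp add: y_word_def)

lemma replicate_zero_append_eq:
  fixes a b :: complex
  assumes "replicate m 0 @ a # u = replicate n 0 @ b # v" "a \<noteq> 0" "b \<noteq> 0"
  shows "m = n \<and> a = b \<and> u = v"
  using assms
proof (induction m arbitrary: n)
  case 0
  then show ?case by (cases n) auto
next
  case (Suc m)
  then show ?case by (cases n) auto
qed

lemma bij_betw_y_word:
  assumes "N \<ge> 1"
  shows "bij_betw y_word (lists ({1..} \<times> Gamma N)) (words1 (insert 0 (Gamma N)))"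
proof -
  have nz: "\<eta> \<noteq> 0" if "\<eta> \<in> Gamma N" for \<eta>
    using that assms by (auto simp: Gamma_def power_0_left)
  have "ys = zs"
    if "ys \<in> lists ({1..} \<times> Gamma N)" "zs \<in> lists ({1..} \<times> Gamma N)" "y_word ys = y_word zs"
    for ys zs
    using that
  proof (induction ys arbitrary: zs rule: list.induct)
    case Nil
    then show ?case by (cases zs) auto
  next
    case (Cons y ys)
    obtain m \<mu> where y: "y = (m, \<mu>)" by force
    from Cons.prems(3) obtain n \<nu> zs' where zs: "zs = (n, \<nu>) # zs'"
      using y by (cases zs) auto
    have "m - 1 = n - 1 \<and> \<mu> = \<nu> \<and> y_word ys = y_word zs'"
      using Cons.prems nz unfolding y zs by (intro replicate_zero_append_eq) auto
    with Cons show ?case unfolding y zs by auto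
  qed
  moreover have "y_word ys \<in> words1 (insert 0 (Gamma N))"
    if "ys \<in> lists ({1..} \<times> Gamma N)" for ys
    using that by (induction ys) (auto simp: words1_def split: if_splits dest: nz)
  moreover have "w \<in> y_word ` lists ({1..} \<times> Gamma N)" if "w \<in> words1 (insert 0 (Gamma N))" for w
    using that
  proof (induction w)
    case Nil
    show ?case by (rule image_eqI[of _ _ "[]"]) auto
  next
    case (Cons a w)
    hence "w \<in> words1 (insert 0 (Gamma N))" by (auto simp: words1_def split: if_splits)
    with Cons obtain ys where ys: "ys \<in> lists ({1..} \<times> Gamma N)" "w = y_word ys" by blast
    show ?case
    proof (cases "a = 0")
      case False
      with Cons.prems have "a \<in> Gamma N" by (auto simp: words1_def)
      with ys show ?thesis by (intro image_eqI[of _ _ "(1, a) # ys"]) auto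
    next
      case True
      with Cons.prems ys obtain m \<mu> zs where zs: "ys = (m, \<mu>) # zs"
        by (cases ys) (auto simp: words1_def)
      with ys True show ?thesis
        by (intro image_eqI[of _ _ "(Suc m, \<mu>) # zs"]) (cases m; auto)+
    qed
  qed
  ultimately show ?thesis
    by (auto simp: bij_betw_def inj_on_def)
qed

definition q_factors :: "(nat \<times> complex) list \<Rightarrow> (nat \<times> complex) list" where
  "q_factors ys =
     map (\<lambda>j. (fst (ys ! j),
               if j = 0 then snd (ys ! j) else snd (ys ! j) * inverse (snd (ys ! (j - 1)))))
         [0..<length ys]"

definition q_map :: "nat \<Rightarrow> ncpoly \<Rightarrow> ncpoly" where
  "q_map N = lin_ext (\<lambda>w. Poly_Mapping.single (y_word (q_factors (y_factors N w))) 1)"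

definition tau :: "ncpoly \<Rightarrow> ncpoly" where
  "tau = lin_ext (\<lambda>w. let ys = y_factors 1 w in
           Poly_Mapping.single (y_word (rev ys)) ((-1) ^ sum_list (map fst ys)))"


section \<open>Finite colored multiple zeta values\<close>

text \<open>
  \<open>transfer_root \<xi> R y\<close> reads \<open>\<eta> = \<xi> ^ e\<close> as \<open>y ^ e\<close> in \<open>R\<close>.
\<close>

definition transfer_root :: "complex \<Rightarrow> 'a ring \<Rightarrow> 'a \<Rightarrow> complex \<Rightarrow> 'a" where
  "transfer_root \<xi> R y \<eta> = y [^]\<^bsub>R\<^esub> (LEAST e::nat. \<xi> ^ e = \<eta>)"

text \<open>
  The \<open>p\<close>-component, indexed by the list \<open>[(s\<^sub>1,\<eta>\<^sub>1),\<dots>,(s\<^sub>d,\<eta>\<^sub>d)]\<close>; for \<open>d = 0\<close> it is \<open>\<one>\<close>.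
\<close>

definition zeta_comp :: "complex \<Rightarrow> 'a ring \<Rightarrow> 'a \<Rightarrow> nat \<Rightarrow> (nat \<times> complex) list \<Rightarrow> 'a" where
  "zeta_comp \<xi> R y p ys =
     (\<Oplus>\<^bsub>R\<^esub>ks\<in>{ks. length ks = length ys \<and> sorted_wrt (>) ks \<and> set ks \<subseteq> {0<..<p}}.
        \<Otimes>\<^bsub>R\<^esub>j\<in>{..<length ys}.
          (transfer_root \<xi> R y (snd (ys ! j)) [^]\<^bsub>R\<^esub> (ks ! j))
          \<otimes>\<^bsub>R\<^esub> inv\<^bsub>R\<^esub> (([ks ! j] \<cdot>\<^bsub>R\<^esub> \<one>\<^bsub>R\<^esub>) [^]\<^bsub>R\<^esub> fst (ys ! j)))"

definition zeta_A ::
  "nat \<Rightarrow> complex \<Rightarrow> (nat \<Rightarrow> 'a ring) \<Rightarrow> (nat \<Rightarrow> 'a) \<Rightarrow> (nat \<times> complex) list \<Rightarrow> (nat \<Rightarrow> 'a) set" where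
  "zeta_A N \<xi> L x ys = A_class N L x (\<lambda>p. zeta_comp \<xi> (L p) (x p) p ys)"

definition zeta_A_star ::
  "nat \<Rightarrow> complex \<Rightarrow> (nat \<Rightarrow> 'a ring) \<Rightarrow> (nat \<Rightarrow> 'a) \<Rightarrow> ncpoly \<Rightarrow> (nat \<Rightarrow> 'a) set" where
  "zeta_A_star N \<xi> L x u =
     (\<Oplus>\<^bsub>A_ring N L x\<^esub>w\<in>Poly_Mapping.keys u.
        A_embed N \<xi> L x (Poly_Mapping.lookup u w)
        \<otimes>\<^bsub>A_ring N L x\<^esub> zeta_A N \<xi> L x (y_factors N w))"

definition zeta_A_shuffle ::
  "nat \<Rightarrow> complex \<Rightarrow> (nat \<Rightarrow> 'a ring) \<Rightarrow> (nat \<Rightarrow> 'a) \<Rightarrow> ncpoly \<Rightarrow> (nat \<Rightarrow> 'a) set" where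
  "zeta_A_shuffle N \<xi> L x = zeta_A_star N \<xi> L x \<circ> q_map N"

end

theory Submission
  imports Defs
begin

text \<open>
  Everything is computed in \<open>\<int>[\<xi>]\<close> localised at \<open>p\<close>, inside the complex numbers, and then reduced
  to the field \<open>L p\<close> by the ring homomorphism with \<open>\<xi> \<mapsto> x p\<close>.  That this homomorphism exists is the
  irreducibility of the cyclotomic polynomial: an integer polynomial vanishing at \<open>\<xi>\<close> also vanishes
  at every primitive \<open>N\<close>th root of unity of every field.

  Attach to a word \<open>w\<close> the power series \<open>\<Sum>\<^sub>k c\<^sub>w(k) t\<^sup>k\<close> of the iterated integral in which \<open>x\<^sub>0\<close> stands
  for \<open>dt/t\<close> and \<open>x\<^sub>\<eta>\<close> for \<open>\<eta> dt/(1 - \<eta> t)\<close>.  Shuffles of words become products of series, and the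
  \<open>p\<close>-component of the shuffle value of \<open>w\<close> is \<open>\<Sum>\<^sub>k c\<^sub>w(k)\<close> over \<open>k < p\<close>.  With \<open>a\<close> and \<open>b\<close> the
  coefficients of the series of \<open>x\<^sub>1 u\<close> and \<open>x\<^sub>1 v\<close>, the values at the shuffles of \<open>y\<^sub>s u\<close> with \<open>v\<close>
  and of \<open>u\<close> with \<open>y\<^sub>s v\<close> (where \<open>y\<^sub>s\<close> is \<open>x\<^sub>0\<close> repeated \<open>s - 1\<close> times followed by \<open>x\<^sub>1\<close>) are
  the sums over \<open>0 < i < p\<close> of \<open>a(i) b(p - i) (p - i) / i ^ (s - 1)\<close> and
  \<open>a(i) b(p - i) i / (p - i) ^ (s - 1)\<close>.  Since \<open>p - i\<close> is congruent to \<open>- i\<close> modulo \<open>p\<close>, they agree up to the sign \<open>(-1) ^ s\<close>.  Moving the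
  factors of \<open>u\<close> over to \<open>v\<close> one at a time gives \<open>\<tau>(u)v\<close>.
\<close>

section \<open>Integer polynomials at a primitive root of unity\<close>

abbreviation cpoly :: "int poly \<Rightarrow> complex poly" where
  "cpoly \<equiv> map_poly of_int"

lemma cpoly_add: "cpoly (f + g) = cpoly f + cpoly g"
  by (intro poly_eqI) (simp add: coeff_map_poly)

lemma cpoly_diff: "cpoly (f - g) = cpoly f - cpoly g"
  by (intro poly_eqI) (simp add: coeff_map_poly)

lemma cpoly_minus: "cpoly (- f) = - cpoly f"
  by (intro poly_eqI) (simp add: coeff_map_poly)

lemma cpoly_mult: "cpoly (f * g) = cpoly f * cpoly g"
  by (intro poly_eqI) (simp add: coeff_map_poly coeff_mult)

lemma cpoly_power: "cpoly (f ^ n) = cpoly f ^ n"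
  by (induction n) (simp_all add: cpoly_mult)

lemma cpoly_prod: "cpoly (\<Prod>i\<in>A. f i) = (\<Prod>i\<in>A. cpoly (f i))"
  by (induction A rule: infinite_finite_induct) (simp_all add: cpoly_mult)

lemma cpoly_eq_0_iff: "cpoly f = 0 \<longleftrightarrow> f = 0"
  by (simp add: map_poly_eq_0_iff)

lemma cpoly_smult: "cpoly (Polynomial.smult c f) = Polynomial.smult (of_int c) (cpoly f)"
  by (intro poly_eqI) (simp add: coeff_map_poly)

lemma cpoly_pCons: "cpoly (pCons c f) = pCons (of_int c) (cpoly f)"
  by (simp add: map_poly_pCons)

lemma cpoly_monom: "cpoly (Polynomial.monom c n) = Polynomial.monom (of_int c) n"
  by (simp add: map_poly_monom)

lemmas cpoly_simps =
  cpoly_add cpoly_diff cpoly_minus cpoly_mult cpoly_power cpoly_prod cpoly_eq_0_iff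
  cpoly_smult cpoly_pCons cpoly_monom poly_monom

text \<open>Values at powers of \<open>\<xi>\<close> thereby become values at \<open>\<xi>\<close>
  of other integer polynomials, that is, elements of \<open>\<int>[\<xi>]\<close>.\<close>

lemma cpoly_pcompose_monom: "poly (cpoly (pcompose f (Polynomial.monom 1 q))) z = poly (cpoly f) (z ^ q)"
  by (induction f) (simp_all add: pcompose_pCons cpoly_simps)

text \<open>Pseudo-division scales the dividend by a power of the leading coefficient. When that is
  a unit, its inverse undoes the scaling and leaves Euclidean division, even over the
  integers.\<close>

lemma divide_by_unit_lead_coeff:
  fixes f g :: "'a::idom poly"
  assumes "Polynomial.lead_coeff f dvd 1"
  obtains q r where "g = f * q + r" "r = 0 \<or> Polynomial.degree r < Polynomial.degree f"
proof -
  let ?a = "Polynomial.lead_coeff f"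
  from assms obtain b where b: "?a * b = 1" by (auto elim: dvdE)
  have f0: "f \<noteq> 0" using assms by auto
  obtain q r where qr: "pseudo_divmod g f = (q, r)" by force
  define n where "n = Suc (Polynomial.degree g) - Polynomial.degree f"
  have "g = Polynomial.smult (b ^ n) (Polynomial.smult (?a ^ n) g)"
    using b by (simp add: power_mult_distrib[symmetric] mult.commute)
  also have "\<dots> = f * Polynomial.smult (b ^ n) q + Polynomial.smult (b ^ n) r"
    using pseudo_divmod(1)[OF f0 qr] by (simp add: n_def smult_add_right)
  finally show ?thesis
    using pseudo_divmod(2)[OF f0 qr] b
    by (intro that[of "Polynomial.smult (b ^ n) q" "Polynomial.smult (b ^ n) r"])
       (auto simp: le_less_trans[OF degree_smult_le])
qed

section \<open>Frobenius congruences modulo a prime\<close>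

lemma freshman_dvd:
  fixes a b :: "'a::comm_ring_1"
  assumes "Factorial_Ring.prime q"
  shows "of_nat q dvd (a + b) ^ q - (a ^ q + b ^ q)"
proof -
  have q: "q > 0" using assms by (simp add: prime_gt_0_nat)
  have *: "{..q} = insert 0 (insert q {0<..<q})" using q by auto
  have "(a + b) ^ q - (a ^ q + b ^ q) = (\<Sum>k\<in>{0<..<q}. of_nat (q choose k) * a ^ k * b ^ (q - k))"
    using q by (subst binomial_ring) (simp add: * algebra_simps)
  also have "of_nat q dvd \<dots>"
  proof (intro dvd_sum)
    fix k assume "k \<in> {0<..<q}"
    hence "q dvd (q choose k)" using assms by (intro dvd_choose_prime) auto
    hence "of_nat q dvd (of_nat (q choose k) :: 'a)" by (auto elim!: dvdE)
    thus "of_nat q dvd of_nat (q choose k) * a ^ k * b ^ (q - k)" by (simp add: mult.assoc dvd_mult2)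
  qed
  finally show ?thesis .
qed

text \<open>Fermat's little theorem: induction on naturals through \<open>freshman_dvd\<close>;
  negative integers are reached via their residue modulo \<open>q\<close>.\<close>

lemma prime_dvd_power_self_diff_int:
  assumes "Factorial_Ring.prime q"
  shows "int q dvd a ^ q - a"
proof -
  have "int q dvd int n ^ q - int n" for n
  proof (induction n)
    case 0
    then show ?case using assms by (simp add: prime_gt_0_nat power_0_left)
  next
    case (Suc n)
    have "int q dvd (int n + 1) ^ q - (int n ^ q + 1)"
      using freshman_dvd[OF assms, of "int n" 1] by simp
    hence "int q dvd ((int n + 1) ^ q - (int n ^ q + 1)) + (int n ^ q - int n)"
      using Suc by (rule dvd_add)
    thus ?case by (simp add: algebra_simps)
  qed
  note nat_case = this
  define n where "n = nat (a mod int q)"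
  have n: "[a = int n] (mod int q)" using assms by (simp add: n_def cong_def prime_gt_0_nat)
  hence "[a ^ q - a = int n ^ q - int n] (mod int q)" by (intro cong_diff cong_pow)
  thus ?thesis using nat_case[of n] by (simp add: cong_dvd_iff)
qed

text \<open>Induction on the coefficients: the binomial congruence splits off the constant term, and
  Fermat's theorem identifies that term with its \<open>q\<close>th power modulo
  \<open>q\<close>.\<close>

lemma frobenius_int_poly:
  fixes f :: "int poly"
  assumes "Factorial_Ring.prime q"
  shows "[:int q:] dvd pcompose f (Polynomial.monom 1 q) - f ^ q"
proof (induction f)
  case 0
  then show ?case using assms by (simp add: prime_gt_0_nat power_0_left)
next
  case (pCons a f)
  have X: "pCons a f = [:a:] + Polynomial.monom 1 1 * f" by (simp add: monom_altdef)
  have c: "(of_nat q :: int poly) = [:int q:]" by (simp add: of_nat_poly)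
  have 1: "[:int q:] dvd (pCons a f) ^ q - ([:a:] ^ q + (Polynomial.monom 1 1 * f) ^ q)"
    using freshman_dvd[OF assms, of "[:a:]" "Polynomial.monom 1 1 * f"] unfolding X c .
  have "[:int q:] dvd [:a ^ q - a:]"
    using prime_dvd_power_self_diff_int[OF assms, of a] by (simp add: const_poly_dvd_const_poly_iff)
  also have "[:a ^ q - a:] = [:a:] ^ q - [:a:]" by (simp add: poly_const_pow)
  finally have 2: "[:int q:] dvd [:a:] ^ q - [:a:]" .
  have 3: "[:int q:] dvd Polynomial.monom 1 q * (pcompose f (Polynomial.monom 1 q) - f ^ q)"
    using pCons.IH by (rule dvd_mult)
  have "pcompose (pCons a f) (Polynomial.monom 1 q) - pCons a f ^ q =
     Polynomial.monom 1 q * (pcompose f (Polynomial.monom 1 q) - f ^ q) - ([:a:] ^ q - [:a:])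
     - ((pCons a f) ^ q - ([:a:] ^ q + (Polynomial.monom 1 1 * f) ^ q))"
    by (simp add: pcompose_pCons power_mult_distrib monom_power algebra_simps)
  also have "[:int q:] dvd \<dots>" by (rule dvd_diff[OF dvd_diff[OF 3 2] 1])
  finally show ?case .
qed

section \<open>The minimal polynomial of \<open>\<xi>\<close> over the integers\<close>

locale primitive_root =
  fixes N :: nat and \<xi> :: complex
  assumes N_pos: "N \<ge> 1" and root: "\<xi> ^ N = 1"
    and primitive: "0 < k \<Longrightarrow> k < N \<Longrightarrow> \<xi> ^ k \<noteq> 1"
begin

text \<open>The polynomial \<open>X^N - 1\<close> annihilates \<open>\<xi>\<close>, so a nonzero
  annihilator of least degree exists; dividing it by its content keeps the root.\<close>

lemma ex_minimal_poly:
  "\<exists>f :: int poly. poly (cpoly f) \<xi> = 0 \<and> content f = 1 \<and>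
    (\<forall>g. poly (cpoly g) \<xi> = 0 \<longrightarrow> g \<noteq> 0 \<longrightarrow> Polynomial.degree f \<le> Polynomial.degree g)"
proof -
  let ?P = "\<lambda>g::int poly. g \<noteq> 0 \<and> poly (cpoly g) \<xi> = 0"
  have "Polynomial.coeff (Polynomial.monom (1::int) N - 1) N \<noteq> 0"
    using N_pos by simp
  hence "?P (Polynomial.monom 1 N - 1)"
    using root by (auto simp: cpoly_simps simp del: coeff_diff)
  then obtain f where f: "?P f" "\<And>g. ?P g \<Longrightarrow> Polynomial.degree f \<le> Polynomial.degree g"
    using ex_has_least_nat[of ?P _ Polynomial.degree] by blast
  have "f = Polynomial.smult (content f) (primitive_part f)" by simp
  hence "cpoly f = Polynomial.smult (of_int (content f)) (cpoly (primitive_part f))"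
    by (metis cpoly_smult)
  hence "poly (cpoly (primitive_part f)) \<xi> = 0" using f(1) by auto
  thus ?thesis using f by (intro exI[of _ "primitive_part f"]) auto
qed

text \<open>Content one fixes it only up to sign, so later arguments use a unit leading coefficient
  instead of the value 1.\<close>

definition minpoly :: "int poly" where
  "minpoly = (SOME f. poly (cpoly f) \<xi> = 0 \<and> content f = 1 \<and>
    (\<forall>g. poly (cpoly g) \<xi> = 0 \<longrightarrow> g \<noteq> 0 \<longrightarrow> Polynomial.degree f \<le> Polynomial.degree g))"

lemma
  shows poly_minpoly: "poly (cpoly minpoly) \<xi> = 0"
    and content_minpoly: "content minpoly = 1"
    and minpoly_minimal: "poly (cpoly g) \<xi> = 0 \<Longrightarrow> g \<noteq> 0 \<Longrightarrow> Polynomial.degree minpoly \<le> Polynomial.degree g"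
  using someI_ex[OF ex_minimal_poly] unfolding minpoly_def by blast+

lemma minpoly_nz: "minpoly \<noteq> 0"
  using content_minpoly by auto

text \<open>Gauss's lemma: by minimality the pseudo-remainder vanishes, and since
  \<open>minpoly\<close> has content one, the constant introduced by pseudo-division divides
  \<open>q\<close> and cancels.\<close>

lemma minpoly_dvd:
  assumes "poly (cpoly g) \<xi> = 0"
  shows "minpoly dvd g"
proof -
  obtain q r where qr: "pseudo_divmod g minpoly = (q, r)" by force
  define c where "c = Polynomial.lead_coeff minpoly ^ (Suc (Polynomial.degree g) - Polynomial.degree minpoly)"
  have c: "c \<noteq> 0" using minpoly_nz by (simp add: c_def)
  have eq: "Polynomial.smult c g = minpoly * q + r"
    using pseudo_divmod(1)[OF minpoly_nz qr] by (simp add: c_def)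
  hence "poly (cpoly (Polynomial.smult c g)) \<xi> = poly (cpoly (minpoly * q + r)) \<xi>" by (simp only:)
  hence "poly (cpoly r) \<xi> = 0" using assms poly_minpoly by (simp add: cpoly_simps)
  hence "r = 0" using minpoly_minimal[of r] pseudo_divmod(2)[OF minpoly_nz qr] by fastforce
  with eq have eq: "Polynomial.smult c g = minpoly * q" by simp
  hence "content (Polynomial.smult c g) = content q"
    by (simp add: content_mult content_minpoly)
  hence "[:c:] dvd q"
    by (subst const_poly_dvd_iff_dvd_content) (auto simp flip: \<open>_ = content q\<close>)
  then obtain q' where "q = [:c:] * q'" by (auto elim: dvdE)
  with eq have "Polynomial.smult c g = Polynomial.smult c (minpoly * q')" by simp
  with c show ?thesis by (metis dvd_triv_left smult_cancel)
qed

text \<open>Up to sign, the product of the cyclotomic polynomials of the proper divisors of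
  \<open>N\<close>.\<close>

definition cofactor :: "int poly" where
  "cofactor = (Polynomial.monom 1 N - 1) div minpoly"

lemma minpoly_cofactor: "Polynomial.monom 1 N - 1 = minpoly * cofactor"
proof -
  have "minpoly dvd Polynomial.monom 1 N - 1"
    using root by (intro minpoly_dvd) (simp add: cpoly_simps)
  thus ?thesis by (simp add: cofactor_def)
qed

lemma lead_coeff_monom_minus_1: "Polynomial.lead_coeff (Polynomial.monom 1 N - 1 :: int poly) = 1"
proof -
  have "Polynomial.degree (Polynomial.monom 1 N - 1 :: int poly) = N"
    using N_pos by (subst diff_conv_add_uminus, subst degree_add_eq_left) (auto simp: degree_monom_eq)
  thus ?thesis using N_pos by simp
qed

lemma lead_coeff_minpoly: "Polynomial.lead_coeff minpoly dvd 1"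
  and lead_coeff_cofactor: "Polynomial.lead_coeff cofactor dvd 1"
proof -
  have "Polynomial.lead_coeff minpoly * Polynomial.lead_coeff cofactor = 1"
    using lead_coeff_monom_minus_1 unfolding minpoly_cofactor lead_coeff_mult .
  thus "Polynomial.lead_coeff minpoly dvd 1" "Polynomial.lead_coeff cofactor dvd 1"
    by (metis dvd_triv_left, metis dvd_triv_right)
qed

section \<open>Landau's proof that \<open>minpoly\<close> vanishes at all primitive roots\<close>

text \<open>Remainders modulo \<open>minpoly\<close> represent elements of
  \<open>\<int>[\<xi>]\<close> uniquely, so an integer dividing the value divides the coefficients
  of the nonzero remainder \<open>r\<close>.\<close>

lemma finite_divisors:
  assumes "poly (cpoly g) \<xi> \<noteq> 0"
  shows "finite {q::nat. \<exists>h. poly (cpoly g) \<xi> = of_nat q * poly (cpoly h) \<xi>}"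
proof -
  obtain a r where g: "g = minpoly * a + r" "r = 0 \<or> Polynomial.degree r < Polynomial.degree minpoly"
    using divide_by_unit_lead_coeff[OF lead_coeff_minpoly] by blast
  have "r \<noteq> 0" using g assms poly_minpoly by (auto simp: cpoly_simps)
  then obtain j where j: "Polynomial.coeff r j \<noteq> 0" by (metis leading_coeff_0_iff)
  have "int q dvd Polynomial.coeff r j"
    if h: "poly (cpoly g) \<xi> = of_nat q * poly (cpoly h) \<xi>" for q h
  proof -
    obtain b s where s: "h = minpoly * b + s" "s = 0 \<or> Polynomial.degree s < Polynomial.degree minpoly"
      using divide_by_unit_lead_coeff[OF lead_coeff_minpoly] by blast
    have "poly (cpoly (r - Polynomial.smult (int q) s)) \<xi> = 0"
      using h poly_minpoly unfolding g(1) s(1) by (simp add: cpoly_simps)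
    moreover have "Polynomial.degree (r - Polynomial.smult (int q) s) < Polynomial.degree minpoly"
      if "r - Polynomial.smult (int q) s \<noteq> 0"
      using g s \<open>r \<noteq> 0\<close> by (intro degree_diff_less) (auto simp: le_less_trans[OF degree_smult_le])
    ultimately have "r - Polynomial.smult (int q) s = 0" using minpoly_minimal by fastforce
    hence "Polynomial.coeff r j = int q * Polynomial.coeff s j" by simp
    thus ?thesis by simp
  qed
  hence "{q::nat. \<exists>h. poly (cpoly g) \<xi> = of_nat q * poly (cpoly h) \<xi>} \<subseteq> {q. int q dvd Polynomial.coeff r j}"
    by blast
  also have "\<dots> \<subseteq> {..nat \<bar>Polynomial.coeff r j\<bar>}"
    using j by (auto dest: dvd_imp_le_int)
  finally show ?thesis by (rule finite_subset) auto
qed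

lemma root_power_mod: "\<xi> ^ (k mod N) = \<xi> ^ k"
proof -
  have "\<xi> ^ k = \<xi> ^ (k mod N + N * (k div N))" by simp
  also have "\<dots> = \<xi> ^ (k mod N)" by (subst power_add) (simp add: power_mult root)
  finally show ?thesis by simp
qed

text \<open>
  Landau's argument: if \<open>minpoly\<close> vanishes at \<open>\<xi> ^ m\<close>, its value at \<open>\<xi> ^ (m * q)\<close> is divisible by the
  prime \<open>q\<close> in \<open>\<int>[\<xi>]\<close>.  Powers of \<open>\<xi>\<close> yield finitely many values, and a nonzero value has finitely
  many integer divisors, so for large \<open>q\<close> the value is zero.
\<close>

lemma minpoly_coprime_power:
  assumes "coprime k N"
  shows "poly (cpoly minpoly) (\<xi> ^ k) = 0"
proof -
  \<comment> \<open>All integers dividing, in \<open>\<int>[\<xi>]\<close>, some nonzero value of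
    \<open>minpoly\<close> at a power of \<open>\<xi>\<close>; exponents below \<open>N\<close>
    cover all powers.\<close>
  define B where "B = (\<Union>k\<in>{k\<in>{..<N}. poly (cpoly minpoly) (\<xi> ^ k) \<noteq> 0}.
     {q::nat. \<exists>h. poly (cpoly minpoly) (\<xi> ^ k) = of_nat q * poly (cpoly h) \<xi>})"
  have "finite B" unfolding B_def
  proof (intro finite_UN_I)
    fix k assume k: "k \<in> {k\<in>{..<N}. poly (cpoly minpoly) (\<xi> ^ k) \<noteq> 0}"
    have "poly (cpoly minpoly) (\<xi> ^ k) = poly (cpoly (pcompose minpoly (Polynomial.monom 1 k))) \<xi>"
      by (simp add: cpoly_pcompose_monom)
    thus "finite {q::nat. \<exists>h. poly (cpoly minpoly) (\<xi> ^ k) = of_nat q * poly (cpoly h) \<xi>}"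
      using finite_divisors k by simp
  qed auto
  then obtain A where A: "\<And>q. q \<in> B \<Longrightarrow> q \<le> A" by (meson finite_nat_set_iff_bounded_le)
  have step: "poly (cpoly minpoly) (\<xi> ^ (m * q)) = 0"
    if q: "Factorial_Ring.prime q" "q > A" and m: "poly (cpoly minpoly) (\<xi> ^ m) = 0" for q m
  proof (rule ccontr)
    assume nz: "poly (cpoly minpoly) (\<xi> ^ (m * q)) \<noteq> 0"
    obtain h where h: "pcompose minpoly (Polynomial.monom 1 q) - minpoly ^ q = [:int q:] * h"
      using frobenius_int_poly[OF q(1)] unfolding dvd_def by blast
    have "poly (cpoly (pcompose minpoly (Polynomial.monom 1 q) - minpoly ^ q)) (\<xi> ^ m) =
          poly (cpoly ([:int q:] * h)) (\<xi> ^ m)" by (simp only: h)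
    hence "poly (cpoly minpoly) (\<xi> ^ (m * q)) = of_nat q * poly (cpoly h) (\<xi> ^ m)"
      using m q(1) by (simp add: cpoly_simps cpoly_pcompose_monom power_mult prime_gt_0_nat power_0_left)
    also have "\<dots> = of_nat q * poly (cpoly (pcompose h (Polynomial.monom 1 m))) \<xi>"
      by (simp add: cpoly_pcompose_monom)
    finally have "q \<in> B" unfolding B_def using nz N_pos root_power_mod[of "m * q"]
      by (intro UN_I[of "m * q mod N"]) auto
    with A q(2) show False by fastforce
  qed
  \<comment> \<open>Prime factors of \<open>m\<close> are peeled off one at a time by
    \<open>step\<close>, starting from \<open>\<xi>\<close> itself.\<close>
  have large: "poly (cpoly minpoly) (\<xi> ^ m) = 0"
    if "m > 0" "\<And>q. Factorial_Ring.prime q \<Longrightarrow> q dvd m \<Longrightarrow> q > A" for m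
    using that
  proof (induction m rule: less_induct)
    case (less m)
    show ?case
    proof (cases "m = 1")
      case True
      then show ?thesis by (simp add: poly_minpoly)
    next
      case False
      then obtain q where q: "Factorial_Ring.prime q" "q dvd m" by (meson prime_factor_nat)
      then obtain m' where m': "m = m' * q" by (metis dvdE mult.commute)
      have "m' < m" "m' > 0" using m' q less.prems(1) prime_gt_1_nat[OF q(1)] by auto
      hence "poly (cpoly minpoly) (\<xi> ^ m') = 0" using less m' by (intro less.IH) auto
      thus ?thesis unfolding m' using q less.prems by (intro step) auto
    qed
  qed
  \<comment> \<open>A prime up to \<open>A\<close> divides exactly one of \<open>k\<close> and
    \<open>N * P\<close>: if it divides \<open>k\<close>, it misses \<open>N\<close> by coprimality
    and \<open>P\<close> by choice; otherwise it is a factor of \<open>P\<close>. So it cannot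
    divide their sum.\<close>
  define P where "P = (\<Prod>q\<in>{q. Factorial_Ring.prime q \<and> q \<le> A \<and> \<not> q dvd k}. q)"
  have fin: "finite {q. Factorial_Ring.prime q \<and> q \<le> A \<and> \<not> q dvd k}" by simp
  \<comment> \<open>congruent to \<open>k\<close> modulo \<open>N\<close>, but with large prime factors only\<close>
  define m where "m = k + N * P"
  have "P > 0" unfolding P_def by (intro prod_pos) (auto simp: prime_gt_0_nat)
  hence "m > 0" using N_pos by (simp add: m_def)
  moreover have "q > A" if q: "Factorial_Ring.prime q" "q dvd m" for q
  proof (rule ccontr)
    assume le: "\<not> q > A"
    show False
    proof (cases "q dvd k")
      case True
      hence "q dvd N * P" using q unfolding m_def by (simp add: dvd_add_right_iff)
      moreover have "\<not> q dvd N" using assms True q(1)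
        by (meson coprime_common_divisor not_prime_unit)
      ultimately have "q dvd P" using q(1) by (simp add: prime_dvd_mult_iff)
      then obtain q' where "Factorial_Ring.prime q'" "\<not> q' dvd k" "q dvd q'"
        unfolding P_def using q(1) fin by (auto simp: prime_dvd_prod_iff)
      thus False using q(1) True by (metis primes_dvd_imp_eq)
    next
      case False
      hence "q dvd P" unfolding P_def using fin le q by (intro dvd_prodI) auto
      thus False using q(2) False unfolding m_def by (simp add: dvd_add_left_iff)
    qed
  qed
  ultimately have "poly (cpoly minpoly) (\<xi> ^ m) = 0" by (rule large)
  thus ?thesis by (simp add: m_def power_add power_mult root)
qed

section \<open>Roots of the cofactor\<close>

lemma inj_on_root_power: "inj_on (\<lambda>k. \<xi> ^ k) {..<N}"
proof -
  have "j = k" if "j \<le> k" "k < N" "\<xi> ^ j = \<xi> ^ k" for j k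
  proof (rule ccontr)
    assume "j \<noteq> k"
    have "\<xi> ^ j * \<xi> ^ (k - j) = \<xi> ^ j * 1"
      unfolding power_add[symmetric] using that by simp
    moreover have "\<xi> \<noteq> 0" using root N_pos by (auto simp: power_0_left)
    ultimately have "\<xi> ^ (k - j) = 1" by simp
    thus False using primitive[of "k - j"] that \<open>j \<noteq> k\<close> by auto
  qed
  thus ?thesis by (intro inj_onI) (metis lessThan_iff nat_le_linear)
qed

text \<open>By counting: the powers are \<open>N\<close> distinct solutions of an equation with
  exactly \<open>N\<close> solutions.\<close>

lemma roots_of_unity_eq: "{z. z ^ N = 1} = (\<lambda>k. \<xi> ^ k) ` {..<N}"
proof (rule sym, rule card_subset_eq)
  show "finite {z::complex. z ^ N = 1}" using N_pos by (intro finite_roots_unity) auto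
  show "(\<lambda>k. \<xi> ^ k) ` {..<N} \<subseteq> {z. z ^ N = 1}"
    by (auto simp: power_mult[symmetric] mult.commute[of _ N]) (simp add: power_mult root)
  show "card ((\<lambda>k. \<xi> ^ k) ` {..<N}) = card {z::complex. z ^ N = 1}"
    using N_pos card_roots_unity_eq[of N] card_image[OF inj_on_root_power] by simp
qed

text \<open>In any field it vanishes exactly where some power with positive exponent below
  \<open>N\<close> equals 1, so an integer identity about it speaks about primitivity in all fields
  at once.\<close>

definition nonprimitive :: "int poly" where
  "nonprimitive = (\<Prod>d\<in>{1..<N}. Polynomial.monom 1 d - 1)"

text \<open>A root \<open>\<xi> ^ k\<close> with \<open>k\<close> coprime to \<open>N\<close> would
  also be a root of \<open>minpoly\<close>, hence a double root of \<open>X^N - 1\<close>, which the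
  derivative excludes. Otherwise its order divides \<open>N / gcd k N\<close>, which is less than
  \<open>N\<close>.\<close>

lemma cofactor_root_nonprimitive:
  assumes "poly (cpoly cofactor) z = 0"
  shows "poly (cpoly nonprimitive) z = 0"
proof -
  have fact: "cpoly (Polynomial.monom 1 N - 1) = cpoly minpoly * cpoly cofactor"
    by (simp only: minpoly_cofactor cpoly_mult)
  hence "poly (cpoly (Polynomial.monom 1 N - 1)) z = 0" using assms by simp
  hence zN: "z ^ N = 1" by (simp add: cpoly_simps)
  then obtain k where k: "k < N" "z = \<xi> ^ k" using roots_of_unity_eq by blast
  have "\<not> coprime k N"
  proof
    assume "coprime k N"
    hence 0: "poly (cpoly minpoly) z = 0" unfolding k by (rule minpoly_coprime_power)
    have "poly (pderiv (cpoly (Polynomial.monom 1 N - 1))) z = 0"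
      unfolding fact using 0 assms by (simp add: pderiv_mult)
    hence "of_nat N * z ^ (N - 1) = 0"
      by (simp add: cpoly_simps pderiv_diff pderiv_monom)
    moreover have "z \<noteq> 0" using zN N_pos by (auto simp: power_0_left)
    ultimately show False using N_pos by simp
  qed
  define g where "g = gcd k N"
  have g: "g > 1" "g dvd N" "g dvd k"
    using \<open>\<not> coprime k N\<close> N_pos unfolding g_def coprime_iff_gcd_eq_1
    by (auto simp: Suc_lessI)
  then obtain d k' where d: "N = g * d" "k = g * k'" by (auto elim!: dvdE)
  have "z ^ d = \<xi> ^ (N * k')" by (simp add: k d mult_ac flip: power_mult)
  also have "\<dots> = 1" by (simp add: power_mult root)
  finally have "z ^ d = 1" .
  moreover have "d > 0" using d N_pos by (cases d) auto
  hence "d \<in> {1..<N}" using d g by simp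
  ultimately show ?thesis
    by (auto simp: nonprimitive_def cpoly_simps poly_prod prod_zero_iff intro!: bexI[of _ d])
qed

text \<open>Over the complex numbers this is the Nullstellensatz in one variable. It descends to the
  integers because the remainder on division by \<open>cofactor\<close> is a complex multiple of
  \<open>cofactor\<close> of smaller degree, hence zero.\<close>

lemma cofactor_dvd_nonprimitive_power: "\<exists>n. cofactor dvd nonprimitive ^ n"
proof -
  define n where "n = Polynomial.degree (cpoly cofactor)"
  have nz: "cofactor \<noteq> 0" using lead_coeff_cofactor by auto
  hence dvd: "cpoly cofactor dvd cpoly nonprimitive ^ n"
    using nullstellensatz_univariate[of "cpoly cofactor" "cpoly nonprimitive"]
      cofactor_root_nonprimitive by (auto simp: n_def cpoly_eq_0_iff)
  obtain q r where qr: "nonprimitive ^ n = cofactor * q + r"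
      "r = 0 \<or> Polynomial.degree r < Polynomial.degree cofactor"
    using divide_by_unit_lead_coeff[OF lead_coeff_cofactor] by blast
  have "cpoly (nonprimitive ^ n) = cpoly (cofactor * q + r)" by (simp only: qr(1))
  hence "cpoly cofactor dvd cpoly r"
    using dvd by (simp add: cpoly_simps) (metis dvd_add_right_iff dvd_triv_left)
  hence "r \<noteq> 0 \<Longrightarrow> Polynomial.degree cofactor \<le> Polynomial.degree r"
    using dvd_imp_degree_le[of "cpoly cofactor" "cpoly r"]
    by (simp add: cpoly_eq_0_iff degree_map_poly)
  hence "r = 0" using qr(2) by fastforce
  with qr(1) show ?thesis by (metis add.right_neutral dvd_triv_left)
qed

section \<open>Inverses up to an integer, and representatives modulo \<open>X^N - 1\<close>\<close>

text \<open>Euclid's algorithm by induction on the degree: dividing \<open>minpoly\<close> by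
  \<open>g\<close> makes the value of \<open>g * q\<close> the negative of the value of a remainder
  of smaller degree, whose inverse is known.\<close>

lemma ex_inverse_multiple:
  assumes "poly (cpoly g) \<xi> \<noteq> 0"
  shows "\<exists>h e. e \<noteq> (0::int) \<and> poly (cpoly g) \<xi> * poly (cpoly h) \<xi> = of_int e"
proof -
  have small: "\<exists>h e. e \<noteq> (0::int) \<and> poly (cpoly g) \<xi> * poly (cpoly h) \<xi> = of_int e"
    if "poly (cpoly g) \<xi> \<noteq> 0" "Polynomial.degree g < Polynomial.degree minpoly" for g
    using that
  proof (induction "Polynomial.degree g" arbitrary: g rule: less_induct)
    case less
    have g0: "g \<noteq> 0" using less.prems(1) by auto
    show ?case
    proof (cases "Polynomial.degree g = 0")
      case True
      then obtain a where "g = [:a:]" by (auto elim: degree_eq_zeroE)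
      with g0 show ?thesis by (intro exI[of _ 1] exI[of _ a]) (simp add: cpoly_simps)
    next
      case False
      obtain q r where qr: "pseudo_divmod minpoly g = (q, r)" by force
      define c where "c = Polynomial.lead_coeff g ^ (Suc (Polynomial.degree minpoly) - Polynomial.degree g)"
      have c: "c \<noteq> 0" using g0 by (simp add: c_def)
      have eq: "Polynomial.smult c minpoly = g * q + r"
        using pseudo_divmod(1)[OF g0 qr] by (simp add: c_def)
      hence "poly (cpoly (Polynomial.smult c minpoly)) \<xi> = poly (cpoly (g * q + r)) \<xi>" by (simp only:)
      hence gq: "poly (cpoly g) \<xi> * poly (cpoly q) \<xi> + poly (cpoly r) \<xi> = 0"
        by (simp add: cpoly_simps poly_minpoly)
      have r: "r = 0 \<or> Polynomial.degree r < Polynomial.degree g" by (rule pseudo_divmod(2)[OF g0 qr])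
      show ?thesis
      proof (cases "r = 0")
        case True
        \<comment> \<open>A zero remainder would factor a multiple of \<open>minpoly\<close>,
          leaving \<open>q\<close> as an annihilator of \<open>\<xi>\<close> of degree too
          small.\<close>
        with gq less.prems have q0: "poly (cpoly q) \<xi> = 0" by (simp add: cpoly_simps)
        have "Polynomial.degree (Polynomial.smult c minpoly) = Polynomial.degree (g * q)" using eq True by simp
        moreover have "q \<noteq> 0" using eq True c minpoly_nz by auto
        ultimately have "Polynomial.degree minpoly = Polynomial.degree g + Polynomial.degree q"
          using c g0 by (simp add: degree_mult_eq)
        with minpoly_minimal[OF q0 \<open>q \<noteq> 0\<close>] False show ?thesis by simp
      next
        case nz: False
        have "poly (cpoly r) \<xi> \<noteq> 0"
          using minpoly_minimal[of r] r nz less.prems(2) by fastforce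
        then obtain h e where "e \<noteq> 0" "poly (cpoly r) \<xi> * poly (cpoly h) \<xi> = of_int e"
          using less.hyps[of r] r nz less.prems by auto
        moreover have "poly (cpoly r) \<xi> = - (poly (cpoly g) \<xi> * poly (cpoly q) \<xi>)"
          using gq by (simp add: eq_neg_iff_add_eq_0 add.commute)
        ultimately show ?thesis
          by (intro exI[of _ "- (q * h)"] exI[of _ e]) (simp add: cpoly_simps mult_ac)
      qed
    qed
  qed
  obtain q r where qr: "g = minpoly * q + r" "r = 0 \<or> Polynomial.degree r < Polynomial.degree minpoly"
    using divide_by_unit_lead_coeff[OF lead_coeff_minpoly] by blast
  have "poly (cpoly g) \<xi> = poly (cpoly r) \<xi>"
    unfolding qr(1) by (simp add: cpoly_simps poly_minpoly)
  thus ?thesis using small[of r] assms qr(2) by (auto simp: cpoly_simps)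
qed

text \<open>Produces the sums over \<open>j < N\<close> that occur in
  \<open>prime_field_adjoin\<close> and \<open>A_embed\<close>.\<close>

lemma ex_cyclic_representative:
  "\<exists>(c::nat \<Rightarrow> int) q. g = (Polynomial.monom 1 N - 1) * q + (\<Sum>j<N. Polynomial.monom (c j) j)"
proof -
  obtain q r where qr: "g = (Polynomial.monom 1 N - 1) * q + r"
     "r = 0 \<or> Polynomial.degree r < Polynomial.degree (Polynomial.monom 1 N - 1 :: int poly)"
    using divide_by_unit_lead_coeff[of "Polynomial.monom 1 N - 1 :: int poly" g] lead_coeff_monom_minus_1
    by auto
  have "Polynomial.degree (Polynomial.monom 1 N - 1 :: int poly) \<le> N"
    by (intro degree_diff_le) (auto simp: degree_monom_le)
  hence r: "r = 0 \<or> Polynomial.degree r < N" using qr(2) by linarith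
  have "r = (\<Sum>j<N. Polynomial.monom (Polynomial.coeff r j) j)"
  proof (rule poly_eqI)
    fix n
    have "Polynomial.coeff r n = 0" if "n \<ge> N" using r that by (auto intro: coeff_eq_0)
    thus "Polynomial.coeff r n = Polynomial.coeff (\<Sum>j<N. Polynomial.monom (Polynomial.coeff r j) j) n"
      by (cases "n < N") (auto simp: coeff_sum if_distrib sum.delta cong: if_cong)
  qed
  thus ?thesis using qr(1) by metis
qed

end

section \<open>The cyclotomic field inside the complex numbers\<close>

context primitive_root
begin

text \<open>The field generated by \<open>\<xi>\<close> over the rationals, written with one common
  integer denominator: only the primes dividing that denominator can obstruct reduction.\<close>

definition rational_span :: "complex set" where
  "rational_span = {z. \<exists>g d. d \<noteq> (0::int) \<and> of_int d * z = poly (cpoly g) \<xi>}"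

lemma rational_span_add:
  assumes "z \<in> rational_span" "w \<in> rational_span"
  shows "z + w \<in> rational_span"
proof -
  from assms obtain g d h e where *: "d \<noteq> 0" "of_int d * z = poly (cpoly g) \<xi>"
     "e \<noteq> 0" "of_int e * w = poly (cpoly h) \<xi>" by (auto simp: rational_span_def)
  have "of_int (d * e) * (z + w) = poly (cpoly (Polynomial.smult e g + Polynomial.smult d h)) \<xi>"
    by (simp add: cpoly_simps algebra_simps flip: *)
  moreover have "d * e \<noteq> 0" using * by simp
  ultimately show ?thesis unfolding rational_span_def by blast
qed

lemma rational_span_mult:
  assumes "z \<in> rational_span" "w \<in> rational_span"
  shows "z * w \<in> rational_span"
proof -
  from assms obtain g d h e where *: "d \<noteq> 0" "of_int d * z = poly (cpoly g) \<xi>"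
     "e \<noteq> 0" "of_int e * w = poly (cpoly h) \<xi>" by (auto simp: rational_span_def)
  have "of_int (d * e) * (z * w) = poly (cpoly (g * h)) \<xi>"
    by (simp add: cpoly_simps algebra_simps flip: *)
  moreover have "d * e \<noteq> 0" using * by simp
  ultimately show ?thesis unfolding rational_span_def by blast
qed

lemma rational_span_eval: "poly (cpoly g) \<xi> \<in> rational_span"
  unfolding rational_span_def by (intro CollectI exI[of _ g] exI[of _ 1]) auto

lemma rational_span_of_int [simp]: "of_int n \<in> rational_span"
  using rational_span_eval[of "[:n:]"] by (simp add: cpoly_simps)

lemma rational_span_01 [simp]: "0 \<in> rational_span" "1 \<in> rational_span"
  using rational_span_of_int[of 0] rational_span_of_int[of 1] by (simp_all del: rational_span_of_int)

lemma rational_span_sum: "(\<And>i. i \<in> A \<Longrightarrow> f i \<in> rational_span) \<Longrightarrow> (\<Sum>i\<in>A. f i) \<in> rational_span"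
  by (induction A rule: infinite_finite_induct) (simp_all add: rational_span_add)

lemma rational_span_inverse:
  assumes "z \<in> rational_span" "z \<noteq> 0"
  shows "inverse z \<in> rational_span"
proof -
  from assms obtain g d where *: "d \<noteq> 0" "of_int d * z = poly (cpoly g) \<xi>" by (auto simp: rational_span_def)
  hence "poly (cpoly g) \<xi> \<noteq> 0" using assms(2) by (metis mult_eq_0_iff of_int_eq_0_iff)
  then obtain h e where h: "e \<noteq> (0::int)" "poly (cpoly g) \<xi> * poly (cpoly h) \<xi> = of_int e"
    using ex_inverse_multiple by blast
  have "of_int e * inverse z = poly (cpoly (Polynomial.smult d h)) \<xi>"
    using assms(2) by (simp add: cpoly_simps flip: h(2) *(2))
  with h(1) show ?thesis unfolding rational_span_def by blast
qed

text \<open>Gives the coefficients of words, known only to lie in a generated subfield, their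
  explicit form; inverses come from \<open>ex_inverse_multiple\<close>.\<close>

lemma cyclotomic_field_subset: "cyclotomic_field N \<subseteq> rational_span"
proof
  interpret C: field complex_ring by (rule field_from_type_algebra)
  have carrier: "carrier complex_ring = UNIV" by (simp add: ring_of_type_algebra_def)
  fix z assume "z \<in> cyclotomic_field N"
  hence "z \<in> generate_field complex_ring (Gamma N)" by (simp add: cyclotomic_field_def)
  thus "z \<in> rational_span"
  proof (induction rule: generate_field.induct)
    case one
    show ?case using rational_span_eval[of 1] by (simp add: ring_of_type_algebra_def)
  next
    case (incl h)
    then obtain k where "h = \<xi> ^ k" using roots_of_unity_eq by (auto simp: Gamma_def)
    thus ?case using rational_span_eval[of "Polynomial.monom 1 k"] by (simp add: cpoly_simps)
  next
    case (a_inv h)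
    have "\<ominus>\<^bsub>complex_ring\<^esub> h = - h"
      by (rule C.minus_equality) (auto simp: ring_of_type_algebra_def)
    also have "- h = poly (cpoly (- 1)) \<xi> * h" by (simp add: cpoly_simps)
    finally show ?case using rational_span_mult[OF rational_span_eval a_inv.IH] by metis
  next
    case (m_inv h)
    have "h \<noteq> 0" using m_inv.hyps by (simp add: ring_of_type_algebra_def)
    hence "inv\<^bsub>complex_ring\<^esub> h = inverse h"
      by (intro C.comm_inv_char) (auto simp: ring_of_type_algebra_def)
    thus ?case using rational_span_inverse[OF m_inv.IH \<open>h \<noteq> 0\<close>] by simp
  next
    case (eng_add h1 h2)
    thus ?case using rational_span_add by (simp add: ring_of_type_algebra_def)
  next
    case (eng_mult h1 h2)
    thus ?case using rational_span_mult by (simp add: ring_of_type_algebra_def)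
  qed
qed

text \<open>Supplies the existence half of the definite description in
  \<open>A_embed\<close>.\<close>

lemma rational_span_representation:
  assumes "z \<in> rational_span"
  shows "\<exists>a :: nat \<Rightarrow> rat. z = (\<Sum>j<N. of_rat (a j) * \<xi> ^ j)"
proof -
  from assms obtain g d where *: "d \<noteq> 0" "of_int d * z = poly (cpoly g) \<xi>" by (auto simp: rational_span_def)
  obtain c q where g: "g = (Polynomial.monom 1 N - 1) * q + (\<Sum>j<N. Polynomial.monom (c j) j)"
    using ex_cyclic_representative by blast
  have sum: "cpoly (\<Sum>j\<in>A. f j) = (\<Sum>j\<in>A. cpoly (f j))" for A and f :: "nat \<Rightarrow> int poly"
    by (induction A rule: infinite_finite_induct) (simp_all add: cpoly_simps)
  have "of_int d * z = (\<Sum>j<N. of_int (c j) * \<xi> ^ j)"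
    unfolding *(2) g by (simp add: cpoly_simps root sum poly_sum)
  hence "z = (\<Sum>j<N. of_int (c j) * \<xi> ^ j) / of_int d" using *(1) by (simp add: field_simps)
  also have "\<dots> = (\<Sum>j<N. of_rat (of_int (c j) / of_int d) * \<xi> ^ j)"
    by (simp add: sum_divide_distrib of_rat_divide)
  finally show ?thesis by (intro exI[of _ "\<lambda>j. of_int (c j) / of_int d"])
qed

end

section \<open>Reduction modulo a prime\<close>

abbreviation embed_int :: "('a, 'b) ring_scheme \<Rightarrow> int \<Rightarrow> 'a" where
  "embed_int R n \<equiv> add_pow R n \<one>\<^bsub>R\<^esub>"

text \<open>Horner's scheme for the ring homomorphism from integer polynomials that sends the
  variable to \<open>x\<close>.\<close>

definition poly_eval :: "('a, 'b) ring_scheme \<Rightarrow> 'a \<Rightarrow> int poly \<Rightarrow> 'a" where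
  "poly_eval R x g = fold_coeffs (\<lambda>a r. embed_int R a \<oplus>\<^bsub>R\<^esub> x \<otimes>\<^bsub>R\<^esub> r) g \<zero>\<^bsub>R\<^esub>"

context cring
begin

lemma embed_int_closed [simp]: "embed_int R n \<in> carrier R"
  by simp

lemma embed_int_0 [simp]: "embed_int R 0 = \<zero>"
  by (simp add: add_pow_def)

lemma embed_int_1 [simp]: "embed_int R 1 = \<one>"
  by simp

lemma embed_int_add: "embed_int R (a + b) = embed_int R a \<oplus> embed_int R b"
  by (simp add: add.int_pow_mult)

lemma embed_int_mult: "embed_int R (a * b) = embed_int R a \<otimes> embed_int R b"
  by (simp add: add_pow_ldistr_int add.int_pow_pow mult.commute)

lemma embed_int_uminus: "embed_int R (- a) = \<ominus> embed_int R a"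
  by (simp add: add.int_pow_neg)

lemma embed_int_of_nat: "embed_int R (int n) = add_pow R n \<one>"
  by (simp add: add_pow_int_ge)

context
  fixes x assumes x: "x \<in> carrier R"
begin

lemma poly_eval_0 [simp]: "poly_eval R x 0 = \<zero>"
  by (simp add: poly_eval_def)

lemma poly_eval_pCons: "poly_eval R x (pCons a g) = embed_int R a \<oplus> x \<otimes> poly_eval R x g"
  using x by (cases "a = 0 \<and> g = 0") (auto simp: poly_eval_def)

lemma poly_eval_closed [simp]: "poly_eval R x g \<in> carrier R"
  using x by (induction g) (simp_all add: poly_eval_pCons)

lemma poly_eval_const [simp]: "poly_eval R x [:a:] = embed_int R a"
  using x by (simp add: poly_eval_pCons)

lemma poly_eval_1 [simp]: "poly_eval R x 1 = \<one>"
  by (simp add: one_pCons)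

lemma poly_eval_add: "poly_eval R x (f + g) = poly_eval R x f \<oplus> poly_eval R x g"
proof (induction f g rule: poly_induct2)
  case (pCons a f b g)
  then show ?case using x
    by (simp add: poly_eval_pCons embed_int_add r_distr a_ac)
qed simp

lemma poly_eval_smult: "poly_eval R x (Polynomial.smult c g) = embed_int R c \<otimes> poly_eval R x g"
proof (induction g)
  case (pCons a g)
  then show ?case using x
    by (simp add: poly_eval_pCons embed_int_mult r_distr m_lcomm)
qed simp

lemma poly_eval_mult: "poly_eval R x (f * g) = poly_eval R x f \<otimes> poly_eval R x g"
proof (induction f)
  case (pCons a f)
  then show ?case using x
    by (simp add: mult_pCons_left poly_eval_add poly_eval_smult poly_eval_pCons l_distr m_assoc)
qed simp

lemma poly_eval_uminus: "poly_eval R x (- g) = \<ominus> poly_eval R x g"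
  using poly_eval_smult[of "-1" g] by (simp add: embed_int_uminus l_minus)

lemma poly_eval_diff: "poly_eval R x (f - g) = poly_eval R x f \<ominus> poly_eval R x g"
  using poly_eval_add[of f "- g"] by (simp add: poly_eval_uminus a_minus_def)

lemma poly_eval_monom: "poly_eval R x (Polynomial.monom c n) = embed_int R c \<otimes> x [^] n"
proof (induction n)
  case 0
  then show ?case by (simp add: monom_0)
next
  case (Suc n)
  then show ?case using x by (simp add: monom_Suc poly_eval_pCons m_lcomm m_comm)
qed

lemma poly_eval_power: "poly_eval R x (f ^ n) = poly_eval R x f [^] n"
  by (induction n) (simp_all add: poly_eval_mult m_comm)

lemma poly_eval_sum:
  assumes "finite A"
  shows "poly_eval R x (\<Sum>i\<in>A. f i) = (\<Oplus>i\<in>A. poly_eval R x (f i))"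
  using assms by (induction A rule: finite_induct) (simp_all add: poly_eval_add)

end

end

context "domain"
begin

lemma poly_eval_prod_eq_0:
  assumes "x \<in> carrier R" "finite A" "poly_eval R x (\<Prod>i\<in>A. f i) = \<zero>"
  shows "\<exists>i\<in>A. poly_eval R x (f i) = \<zero>"
  using assms(2,3,1)
  by (induction A rule: finite_induct) (auto simp: poly_eval_mult integral_iff)

lemma pow_eq_0: "a \<in> carrier R \<Longrightarrow> a [^] (n::nat) = \<zero> \<Longrightarrow> a = \<zero>"
  by (induction n) (auto simp: integral_iff)

end

section \<open>The homomorphism from \<open>\<int>[\<xi>]\<close> to a field of characteristic
  \<open>p\<close>\<close>

locale root_reduction = primitive_root N \<xi> + field L
  for N :: nat and \<xi> :: complex and L :: "'a ring" (structure) +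
  fixes p :: nat and x :: 'a
  assumes prime_p: "Factorial_Ring.prime p"
    and char_p: "embed_int L (int p) = \<zero>"
    and x_closed [simp]: "x \<in> carrier L"
    and x_root: "x [^] N = \<one>"
    and x_primitive: "0 < k \<Longrightarrow> k < N \<Longrightarrow> x [^] k \<noteq> \<one>"
begin

text \<open>As a root of \<open>minpoly * cofactor\<close>, \<open>x\<close> is a root of one
  factor. A root of \<open>cofactor\<close> is a root of a power of \<open>nonprimitive\<close>,
  against the primitivity of \<open>x\<close>; so \<open>minpoly\<close>, and with it its multiple
  \<open>g\<close>, vanishes at \<open>x\<close>.\<close>

lemma eval_eq_0:
  assumes "poly (cpoly g) \<xi> = 0"
  shows "poly_eval L x g = \<zero>"
proof -
  have "poly_eval L x (minpoly * cofactor) = \<zero>"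
    unfolding minpoly_cofactor[symmetric]
    by (simp add: poly_eval_diff poly_eval_monom x_root a_minus_def r_neg)
  hence "poly_eval L x minpoly = \<zero> \<or> poly_eval L x cofactor = \<zero>"
    by (simp add: poly_eval_mult integral_iff)
  moreover have "poly_eval L x cofactor \<noteq> \<zero>"
  proof
    assume 0: "poly_eval L x cofactor = \<zero>"
    obtain n q where "nonprimitive ^ n = cofactor * q"
      using cofactor_dvd_nonprimitive_power unfolding dvd_def by blast
    hence "poly_eval L x (nonprimitive ^ n) = poly_eval L x (cofactor * q)" by simp
    also have "\<dots> = \<zero>" by (simp add: poly_eval_mult 0)
    finally have "poly_eval L x nonprimitive [^] n = \<zero>" by (simp add: poly_eval_power)
    hence "poly_eval L x nonprimitive = \<zero>" by (rule pow_eq_0[rotated]) simp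
    then obtain d where d: "d \<in> {1..<N}" "poly_eval L x (Polynomial.monom 1 d - 1) = \<zero>"
      unfolding nonprimitive_def using poly_eval_prod_eq_0[OF x_closed finite_atLeastLessThan] by blast
    hence "x [^] d = \<one>" by (simp add: poly_eval_diff poly_eval_monom r_right_minus_eq)
    with x_primitive[of d] d(1) show False by simp
  qed
  ultimately have "poly_eval L x minpoly = \<zero>" by simp
  moreover obtain q where "g = minpoly * q"
    using minpoly_dvd[OF assms] unfolding dvd_def by blast
  ultimately show ?thesis by (simp add: poly_eval_mult)
qed

lemma eval_eqI:
  assumes "poly (cpoly f) \<xi> = poly (cpoly g) \<xi>"
  shows "poly_eval L x f = poly_eval L x g"
  using eval_eq_0[of "f - g"] assms by (simp add: cpoly_simps poly_eval_diff r_right_minus_eq)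

section \<open>Extending the reduction to denominators prime to \<open>p\<close>\<close>

lemma embed_int_cong:
  assumes "[a = b] (mod int p)"
  shows "embed_int L a = embed_int L b"
proof -
  obtain k where k: "a = b + int p * k" using assms by (metis cong_iff_lin cong_sym)
  show ?thesis unfolding k by (simp only: embed_int_add embed_int_mult char_p) simp
qed

lemma ex_mod_inverse:
  assumes "\<not> int p dvd d"
  obtains e where "embed_int L d \<otimes> embed_int L e = \<one>" "[d * e = 1] (mod int p)"
proof -
  have "coprime d (int p)"
    using assms prime_p prime_imp_coprime[of "int p" d] by (simp add: coprime_commute)
  then obtain e where e: "[d * e = 1] (mod int p)" using cong_solve_coprime_int by blast
  hence "embed_int L (d * e) = \<one>" using embed_int_cong embed_int_1 by metis
  with e that show ?thesis by (simp add: embed_int_mult)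
qed

lemma embed_int_nz: "\<not> int p dvd d \<Longrightarrow> embed_int L d \<noteq> \<zero>"
  using ex_mod_inverse[of d] by (metis embed_int_closed l_null one_not_zero)

text \<open>The localisation of \<open>\<int>[\<xi>]\<close> at the integers prime to \<open>p\<close>.\<close>

definition loc :: "complex set" where
  "loc = {z. \<exists>g d. \<not> int p dvd d \<and> of_int d * z = poly (cpoly g) \<xi>}"

text \<open>The graph of the reduction, cross-multiplied so that ring operations are checked on
  numerators and denominators; any one fraction representing \<open>z\<close> may witness
  it.\<close>

definition is_red :: "complex \<Rightarrow> 'a \<Rightarrow> bool" where
  "is_red z y \<longleftrightarrow> y \<in> carrier L \<and>
     (\<exists>g d. \<not> int p dvd d \<and> of_int d * z = poly (cpoly g) \<xi> \<and> embed_int L d \<otimes> y = poly_eval L x g)"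

text \<open>The default \<zero> outside \<open>loc\<close> keeps every value in the coefficient
  ring; for fixed \<open>z\<close> in the cyclotomic field it occurs at finitely many primes
  only.\<close>

definition red :: "complex \<Rightarrow> 'a" where
  "red z = (if z \<in> loc then THE y. is_red z y else \<zero>)"

lemma not_dvd_mult: "\<not> int p dvd a \<Longrightarrow> \<not> int p dvd b \<Longrightarrow> \<not> int p dvd a * b"
  using prime_p by (simp add: prime_dvd_mult_iff)

text \<open>For two fractions of the same number, the cross-multiplied numerators agree at
  \<open>\<xi>\<close>, hence at \<open>x\<close> by \<open>eval_eqI\<close>.\<close>

lemma is_red_unique:
  assumes "is_red z y" "is_red z y'"
  shows "y = y'"
proof -
  from assms obtain g d g' d' where *: "y \<in> carrier L" "y' \<in> carrier L"
     "\<not> int p dvd d" "of_int d * z = poly (cpoly g) \<xi>" "embed_int L d \<otimes> y = poly_eval L x g"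
     "\<not> int p dvd d'" "of_int d' * z = poly (cpoly g') \<xi>" "embed_int L d' \<otimes> y' = poly_eval L x g'"
    unfolding is_red_def by blast
  have "poly (cpoly (Polynomial.smult d' g)) \<xi> = poly (cpoly (Polynomial.smult d g')) \<xi>"
    using *(4,7) by (simp add: cpoly_simps mult_ac flip: *(4,7))
  hence "embed_int L d' \<otimes> (embed_int L d \<otimes> y) = embed_int L d \<otimes> (embed_int L d' \<otimes> y')"
    unfolding * by (simp flip: poly_eval_smult) (rule eval_eqI)
  hence "(embed_int L d' \<otimes> embed_int L d) \<otimes> y = (embed_int L d' \<otimes> embed_int L d) \<otimes> y'"
    using *(1,2) by (simp add: m_ac)
  moreover have "embed_int L d' \<otimes> embed_int L d \<noteq> \<zero>"
    using * embed_int_nz by (simp add: integral_iff)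
  ultimately show ?thesis using * by (simp add: m_lcancel)
qed

lemma is_red_exists: "z \<in> loc \<Longrightarrow> \<exists>y. is_red z y"
proof -
  assume "z \<in> loc"
  then obtain g d where d: "\<not> int p dvd d" "of_int d * z = poly (cpoly g) \<xi>" by (auto simp: loc_def)
  obtain e where e: "embed_int L d \<otimes> embed_int L e = \<one>" using ex_mod_inverse[OF d(1)] .
  have "embed_int L d \<otimes> (embed_int L e \<otimes> poly_eval L x g) = poly_eval L x g"
    by (subst m_assoc[symmetric]) (simp_all add: e)
  with d show ?thesis unfolding is_red_def by (intro exI[of _ "embed_int L e \<otimes> poly_eval L x g"]) auto
qed

lemma is_red_loc: "is_red z y \<Longrightarrow> z \<in> loc"
  by (auto simp: is_red_def loc_def)

lemma red_eqI: "is_red z y \<Longrightarrow> red z = y"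
  unfolding red_def using is_red_unique is_red_loc by (auto intro: the_equality)

lemma is_red_red: "z \<in> loc \<Longrightarrow> is_red z (red z)"
  using is_red_exists red_eqI by blast

lemma red_closed [simp]: "red z \<in> carrier L"
  using is_red_red[of z] by (cases "z \<in> loc") (auto simp: is_red_def red_def)

lemma is_red_eval: "is_red (poly (cpoly g) \<xi>) (poly_eval L x g)"
proof -
  have "\<not> int p dvd 1" using prime_gt_1_nat[OF prime_p] by simp
  thus ?thesis unfolding is_red_def by (intro conjI exI[of _ g] exI[of _ 1]) auto
qed

lemma is_red_add:
  assumes "is_red z y" "is_red z' y'"
  shows "is_red (z + z') (y \<oplus> y')"
proof -
  from assms obtain g d g' d' where *: "y \<in> carrier L" "y' \<in> carrier L"
     "\<not> int p dvd d" "of_int d * z = poly (cpoly g) \<xi>" "embed_int L d \<otimes> y = poly_eval L x g"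
     "\<not> int p dvd d'" "of_int d' * z' = poly (cpoly g') \<xi>" "embed_int L d' \<otimes> y' = poly_eval L x g'"
    unfolding is_red_def by blast
  have "embed_int L (d * d') \<otimes> (y \<oplus> y') =
      embed_int L d' \<otimes> (embed_int L d \<otimes> y) \<oplus> embed_int L d \<otimes> (embed_int L d' \<otimes> y')"
    using *(1,2) by (simp add: embed_int_mult l_distr r_distr m_ac)
  also have "\<dots> = poly_eval L x (Polynomial.smult d' g + Polynomial.smult d g')"
    unfolding * by (simp add: poly_eval_add poly_eval_smult)
  finally show ?thesis unfolding is_red_def
    using * not_dvd_mult
    by (intro conjI exI[of _ "Polynomial.smult d' g + Polynomial.smult d g'"] exI[of _ "d * d'"])
       (auto simp: cpoly_simps algebra_simps simp flip: *(4,7))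
qed

lemma is_red_mult:
  assumes "is_red z y" "is_red z' y'"
  shows "is_red (z * z') (y \<otimes> y')"
proof -
  from assms obtain g d g' d' where *: "y \<in> carrier L" "y' \<in> carrier L"
     "\<not> int p dvd d" "of_int d * z = poly (cpoly g) \<xi>" "embed_int L d \<otimes> y = poly_eval L x g"
     "\<not> int p dvd d'" "of_int d' * z' = poly (cpoly g') \<xi>" "embed_int L d' \<otimes> y' = poly_eval L x g'"
    unfolding is_red_def by blast
  have "embed_int L (d * d') \<otimes> (y \<otimes> y') = (embed_int L d \<otimes> y) \<otimes> (embed_int L d' \<otimes> y')"
    using *(1,2) by (simp add: embed_int_mult m_ac)
  also have "\<dots> = poly_eval L x (g * g')"
    unfolding * by (simp add: poly_eval_mult)
  finally show ?thesis unfolding is_red_def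
    using * not_dvd_mult
    by (intro conjI exI[of _ "g * g'"] exI[of _ "d * d'"])
       (auto simp: cpoly_simps mult_ac simp flip: *(4,7))
qed

lemma is_red_divide:
  assumes "is_red z y" "\<not> int p dvd d"
  shows "is_red (z / of_int d) (y \<otimes> inv (embed_int L d))"
proof -
  from assms obtain g d' where *: "y \<in> carrier L"
     "\<not> int p dvd d'" "of_int d' * z = poly (cpoly g) \<xi>" "embed_int L d' \<otimes> y = poly_eval L x g"
    unfolding is_red_def by blast
  have inv: "inv (embed_int L d) \<in> carrier L" "embed_int L d \<otimes> inv (embed_int L d) = \<one>"
    using embed_int_nz[OF assms(2)] by (auto simp: field_Units)
  have "embed_int L (d * d') \<otimes> (y \<otimes> inv (embed_int L d)) =
      (embed_int L d \<otimes> inv (embed_int L d)) \<otimes> (embed_int L d' \<otimes> y)"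
    using inv(1) *(1) by (simp add: embed_int_mult m_ac)
  also have "\<dots> = poly_eval L x g" by (simp add: inv *)
  finally have "embed_int L (d * d') \<otimes> (y \<otimes> inv (embed_int L d)) = poly_eval L x g" .
  moreover have "d \<noteq> 0" using assms(2) by auto
  ultimately show ?thesis unfolding is_red_def using * inv not_dvd_mult assms(2)
    by (intro conjI exI[of _ g] exI[of _ "d * d'"]) (auto simp flip: *(3))
qed

lemma red_add: "z \<in> loc \<Longrightarrow> z' \<in> loc \<Longrightarrow> red (z + z') = red z \<oplus> red z'"
  and red_mult: "z \<in> loc \<Longrightarrow> z' \<in> loc \<Longrightarrow> red (z * z') = red z \<otimes> red z'"
  and red_divide: "z \<in> loc \<Longrightarrow> \<not> int p dvd d \<Longrightarrow> red (z / of_int d) = red z \<otimes> inv (embed_int L d)"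
  and red_eval: "red (poly (cpoly g) \<xi>) = poly_eval L x g"
  by (blast intro: red_eqI is_red_add is_red_mult is_red_divide is_red_eval is_red_red)+

lemma loc_add: "z \<in> loc \<Longrightarrow> z' \<in> loc \<Longrightarrow> z + z' \<in> loc"
  and loc_mult: "z \<in> loc \<Longrightarrow> z' \<in> loc \<Longrightarrow> z * z' \<in> loc"
  and loc_divide: "z \<in> loc \<Longrightarrow> \<not> int p dvd d \<Longrightarrow> z / of_int d \<in> loc"
  and loc_eval: "poly (cpoly g) \<xi> \<in> loc"
  by (blast intro: is_red_loc is_red_add is_red_mult is_red_divide is_red_eval is_red_red)+

lemma red_of_int: "red (of_int n) = embed_int L n" and loc_of_int: "of_int n \<in> loc"
  using red_eval[of "[:n:]"] loc_eval[of "[:n:]"] by (simp_all add: cpoly_simps)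

lemma red_root: "red \<xi> = x" and loc_root: "\<xi> \<in> loc"
  using red_eval[of "Polynomial.monom 1 1"] loc_eval[of "Polynomial.monom 1 1"]
  by (simp_all add: cpoly_simps poly_eval_monom)

lemma red_0 [simp]: "red 0 = \<zero>" and loc_0 [simp]: "0 \<in> loc"
  using red_of_int[of 0] loc_of_int[of 0] by simp_all

lemma red_1 [simp]: "red 1 = \<one>" and loc_1 [simp]: "1 \<in> loc"
  using red_of_int[of 1] loc_of_int[of 1] by simp_all

lemma loc_power: "z \<in> loc \<Longrightarrow> z ^ n \<in> loc" 
  by (induction n) (simp_all add: loc_mult)

lemma red_power: "z \<in> loc \<Longrightarrow> red (z ^ n) = red z [^] n"
  by (induction n) (simp_all add: loc_power red_mult m_comm)

lemma loc_sum: "(\<And>i. i \<in> A \<Longrightarrow> f i \<in> loc) \<Longrightarrow> (\<Sum>i\<in>A. f i) \<in> loc"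
  by (induction A rule: infinite_finite_induct) (simp_all add: loc_add)

lemma loc_prod: "(\<And>i. i \<in> A \<Longrightarrow> f i \<in> loc) \<Longrightarrow> (\<Prod>i\<in>A. f i) \<in> loc"
  by (induction A rule: infinite_finite_induct) (simp_all add: loc_mult)

lemma red_sum:
  assumes "finite A" "\<And>i. i \<in> A \<Longrightarrow> f i \<in> loc"
  shows "red (\<Sum>i\<in>A. f i) = (\<Oplus>i\<in>A. red (f i))"
  using assms by (induction A rule: finite_induct) (simp_all add: red_add loc_sum)

lemma red_prod:
  assumes "finite A" "\<And>i. i \<in> A \<Longrightarrow> f i \<in> loc"
  shows "red (\<Prod>i\<in>A. f i) = (\<Otimes>i\<in>A. red (f i))"
  using assms by (induction A rule: finite_induct) (simp_all add: red_mult loc_prod)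

text \<open>Congruences are proved among complex numbers with an explicit factor \<open>p\<close>;
  here they turn into equalities in \<open>L\<close>.\<close>

lemma red_multiple_p: "z \<in> loc \<Longrightarrow> red (of_nat p * z) = \<zero>"
  using red_mult[OF loc_of_int[of "int p"], of z] red_of_int[of "int p"] by (simp add: char_p)

section \<open>The coefficient ring generated by \<open>x\<close>\<close>

text \<open>Reduction modulo \<open>X^N - 1\<close>, which vanishes at \<open>x\<close>, shortens
  any polynomial to \<open>N\<close> terms; as a range of \<open>poly_eval\<close> the carrier is
  visibly closed under multiplication.\<close>

lemma carrier_adjoin: "carrier (prime_field_adjoin L N x) = range (poly_eval L x)"
proof -
  have eq: "(\<Oplus>j\<in>{..<N}. embed_int L (c j) \<otimes> x [^] j) = poly_eval L x (\<Sum>j<N. Polynomial.monom (c j) j)" for c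
    by (simp add: poly_eval_sum poly_eval_monom)
  have "poly_eval L x g \<in> carrier (prime_field_adjoin L N x)" for g
  proof -
    obtain c q where g: "g = (Polynomial.monom 1 N - 1) * q + (\<Sum>j<N. Polynomial.monom (c j) j)"
      using ex_cyclic_representative by blast
    have "poly (cpoly (Polynomial.monom 1 N - 1)) \<xi> = 0" using root by (simp add: cpoly_simps)
    hence "poly_eval L x (Polynomial.monom 1 N - 1) = \<zero>" by (rule eval_eq_0)
    hence "poly_eval L x g = (\<Oplus>j\<in>{..<N}. embed_int L (c j) \<otimes> x [^] j)"
      unfolding g eq by (simp add: poly_eval_add poly_eval_mult)
    thus ?thesis by (auto simp: prime_field_adjoin_def)
  qed
  thus ?thesis by (auto simp: prime_field_adjoin_def eq)
qed

text \<open>The denominator has an integer inverse modulo \<open>p\<close>, which is absorbed into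
  the polynomial.\<close>

lemma red_in_adjoin: "red z \<in> carrier (prime_field_adjoin L N x)"
proof (cases "z \<in> loc")
  case True
  from is_red_red[OF this] obtain g d where d: "\<not> int p dvd d" "embed_int L d \<otimes> red z = poly_eval L x g"
    by (auto simp: is_red_def)
  obtain e where e: "embed_int L d \<otimes> embed_int L e = \<one>" using ex_mod_inverse[OF d(1)] .
  have "red z = (embed_int L d \<otimes> embed_int L e) \<otimes> red z" by (simp add: e)
  also have "\<dots> = embed_int L e \<otimes> (embed_int L d \<otimes> red z)" by (simp add: m_ac)
  also have "\<dots> = poly_eval L x (Polynomial.smult e g)" by (simp add: d poly_eval_smult)
  finally show ?thesis by (simp add: carrier_adjoin)
next
  case False
  hence "red z = poly_eval L x 0" by (simp add: red_def)
  thus ?thesis by (simp only: carrier_adjoin rangeI)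
qed

lemma subring_adjoin: "subring (carrier (prime_field_adjoin L N x)) L"
  unfolding carrier_adjoin
proof (rule subringI)
  show "range (poly_eval L x) \<subseteq> carrier L" by auto
  show "\<one> \<in> range (poly_eval L x)" using rangeI[of "poly_eval L x" 1] by simp
  show "\<ominus> h \<in> range (poly_eval L x)" if "h \<in> range (poly_eval L x)" for h
    using that by (auto simp flip: poly_eval_uminus)
  show "h1 \<otimes> h2 \<in> range (poly_eval L x)" "h1 \<oplus> h2 \<in> range (poly_eval L x)"
    if "h1 \<in> range (poly_eval L x)" "h2 \<in> range (poly_eval L x)" for h1 h2
    using that by (auto simp flip: poly_eval_mult poly_eval_add)
qed

lemma ring_adjoin: "ring (prime_field_adjoin L N x)"
  using subring_is_ring[OF subring_adjoin] by (simp add: prime_field_adjoin_def)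

end

section \<open>The ring A(N) and its structure map\<close>

lemma ring_product_ring:
  assumes "\<And>i. i \<in> I \<Longrightarrow> ring (R i)"
  shows "ring (product_ring I R)"
proof (rule ringI)
  note rs = ring.ring_simprules[OF assms]
  show "abelian_group (product_ring I R)"
  proof (rule abelian_groupI)
    fix f assume f: "f \<in> carrier (product_ring I R)"
    show "\<exists>g\<in>carrier (product_ring I R). g \<oplus>\<^bsub>product_ring I R\<^esub> f = \<zero>\<^bsub>product_ring I R\<^esub>"
      by (rule bexI[of _ "\<lambda>i\<in>I. \<ominus>\<^bsub>R i\<^esub> f i"])
         (use f in \<open>auto simp: product_ring_def PiE_iff rs\<close>)
  qed (auto simp: product_ring_def PiE_iff rs extensional_def fun_eq_iff)
  show "Group.monoid (product_ring I R)"
    by (rule monoidI)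
       (auto simp: product_ring_def PiE_iff rs monoid.r_one[OF ring.is_monoid[OF assms]] extensional_def fun_eq_iff)
qed (auto simp: product_ring_def PiE_iff ring.ring_simprules[OF assms] extensional_def fun_eq_iff)

lemma ideal_direct_sum:
  assumes "\<And>i. i \<in> I \<Longrightarrow> ring (R i)"
  shows "ideal (direct_sum I R) (product_ring I R)"
proof -
  interpret P: ring "product_ring I R" using assms by (rule ring_product_ring)
  note rs = ring.ring_simprules[OF assms]
  have minus: "\<ominus>\<^bsub>product_ring I R\<^esub> f = (\<lambda>i\<in>I. \<ominus>\<^bsub>R i\<^esub> f i)"
    if "f \<in> carrier (product_ring I R)" for f
    using that by (intro P.minus_equality) (auto simp: product_ring_def PiE_iff rs)
  show ?thesis
  proof (rule idealI)
    show "ring (product_ring I R)" by (rule P.ring_axioms)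
    show "subgroup (direct_sum I R) (add_monoid (product_ring I R))"
    proof (rule P.add.subgroupI)
      show "direct_sum I R \<subseteq> carrier (product_ring I R)" by (auto simp: direct_sum_def)
      have "\<zero>\<^bsub>product_ring I R\<^esub> \<in> direct_sum I R"
        by (simp add: direct_sum_def) (simp add: product_ring_def)
      thus "direct_sum I R \<noteq> {}" by blast
      show "\<ominus>\<^bsub>product_ring I R\<^esub> f \<in> direct_sum I R" if f: "f \<in> direct_sum I R" for f
      proof -
        have c: "f \<in> carrier (product_ring I R)" using f by (simp add: direct_sum_def)
        have "{i\<in>I. \<ominus>\<^bsub>R i\<^esub> f i \<noteq> \<zero>\<^bsub>R i\<^esub>} \<subseteq> {i\<in>I. f i \<noteq> \<zero>\<^bsub>R i\<^esub>}"
          using assms by (auto simp: rs)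
        hence "finite {i\<in>I. \<ominus>\<^bsub>R i\<^esub> f i \<noteq> \<zero>\<^bsub>R i\<^esub>}"
          using f by (auto simp: direct_sum_def intro: finite_subset)
        moreover have "{i\<in>I. (\<lambda>i\<in>I. \<ominus>\<^bsub>R i\<^esub> f i) i \<noteq> \<zero>\<^bsub>R i\<^esub>} = {i\<in>I. \<ominus>\<^bsub>R i\<^esub> f i \<noteq> \<zero>\<^bsub>R i\<^esub>}" by auto
        ultimately show ?thesis using P.a_inv_closed[OF c] unfolding minus[OF c]
          by (simp add: direct_sum_def)
      qed
      show "f \<oplus>\<^bsub>product_ring I R\<^esub> g \<in> direct_sum I R"
        if fg: "f \<in> direct_sum I R" "g \<in> direct_sum I R" for f g
      proof -
        have c: "f \<in> carrier (product_ring I R)" "g \<in> carrier (product_ring I R)"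
          using fg by (simp_all add: direct_sum_def)
        have "{i\<in>I. (f \<oplus>\<^bsub>product_ring I R\<^esub> g) i \<noteq> \<zero>\<^bsub>R i\<^esub>} \<subseteq> {i\<in>I. f i \<noteq> \<zero>\<^bsub>R i\<^esub>} \<union> {i\<in>I. g i \<noteq> \<zero>\<^bsub>R i\<^esub>}"
          by (auto simp: product_ring_def rs)
        hence "finite {i\<in>I. (f \<oplus>\<^bsub>product_ring I R\<^esub> g) i \<noteq> \<zero>\<^bsub>R i\<^esub>}"
          using fg by (auto simp: direct_sum_def intro: finite_subset)
        with P.a_closed[OF c] show ?thesis by (simp add: direct_sum_def)
      qed
    qed
    fix f g assume f: "f \<in> direct_sum I R" and g: "g \<in> carrier (product_ring I R)"
    have c: "f \<in> carrier (product_ring I R)" using f by (simp add: direct_sum_def)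
    have "{i\<in>I. (g \<otimes>\<^bsub>product_ring I R\<^esub> f) i \<noteq> \<zero>\<^bsub>R i\<^esub>} \<subseteq> {i\<in>I. f i \<noteq> \<zero>\<^bsub>R i\<^esub>}"
         "{i\<in>I. (f \<otimes>\<^bsub>product_ring I R\<^esub> g) i \<noteq> \<zero>\<^bsub>R i\<^esub>} \<subseteq> {i\<in>I. f i \<noteq> \<zero>\<^bsub>R i\<^esub>}"
      using g by (auto simp: product_ring_def PiE_iff rs)
    hence "finite {i\<in>I. (g \<otimes>\<^bsub>product_ring I R\<^esub> f) i \<noteq> \<zero>\<^bsub>R i\<^esub>}"
          "finite {i\<in>I. (f \<otimes>\<^bsub>product_ring I R\<^esub> g) i \<noteq> \<zero>\<^bsub>R i\<^esub>}"
      using f by (auto simp: direct_sum_def intro: finite_subset)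
    with P.m_closed[OF c g] P.m_closed[OF g c]
    show "g \<otimes>\<^bsub>product_ring I R\<^esub> f \<in> direct_sum I R" "f \<otimes>\<^bsub>product_ring I R\<^esub> g \<in> direct_sum I R"
      by (simp_all add: direct_sum_def)
  qed
qed

lemma ring_hom_embed_int:
  assumes "ring R" "ring S" "h \<in> ring_hom R S"
  shows "h (add_pow R (n::nat) \<one>\<^bsub>R\<^esub>) = add_pow S n \<one>\<^bsub>S\<^esub>"
proof -
  interpret R: ring R by fact
  interpret S: ring S by fact
  interpret h: ring_hom_ring R S h using assms by (intro ring_hom_ringI2)
  show ?thesis by (induction n) simp_all
qed

text \<open>The homomorphism from the residue ring, in which \<open>p\<close> times one is zero,
  carries the characteristic over to \<open>L\<close>.\<close>

lemma alg_closure_of_prime_fieldD: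
  assumes "alg_closure_of_prime_field p L" "Factorial_Ring.prime p"
  shows "field L" "embed_int L (int p) = \<zero>\<^bsub>L\<^esub>"
proof -
  from assms(1) obtain h where h: "h \<in> ring_hom (residue_ring (int p)) L"
      "algebraic_closure L (h ` carrier (residue_ring (int p)))"
    unfolding alg_closure_of_prime_field_def by blast
  interpret algebraic_closure L "h ` carrier (residue_ring (int p))" by fact
  show "field L" by (rule field_axioms)
  interpret res: residues_prime p "residue_ring (int p)"
    using assms(2) by unfold_locales auto
  have "add_pow (residue_ring (int p)) n \<one>\<^bsub>residue_ring (int p)\<^esub> = int n mod int p" for n :: nat
    by (induction n) (simp_all add: res.zero_cong res.one_cong res.add_cong res.res_add_eq mod_simps ac_simps)
  hence "add_pow (residue_ring (int p)) p \<one>\<^bsub>residue_ring (int p)\<^esub> = \<zero>\<^bsub>residue_ring (int p)\<^esub>"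
    by (simp add: res.res_zero_eq)
  hence "add_pow L p \<one>\<^bsub>L\<^esub> = h \<zero>\<^bsub>residue_ring (int p)\<^esub>"
    using ring_hom_embed_int[OF res.ring_axioms ring_axioms h(1), of p] by simp
  also have "\<dots> = \<zero>\<^bsub>L\<^esub>" using ring_hom_zero[OF h(1) res.ring_axioms ring_axioms] .
  finally show "embed_int L (int p) = \<zero>\<^bsub>L\<^esub>" by (simp add: embed_int_of_nat)
qed

lemma finite_dvd: "d \<noteq> 0 \<Longrightarrow> finite {p. int p dvd d}"
proof -
  assume d: "d \<noteq> 0"
  have "{p. int p dvd d} \<subseteq> {..nat \<bar>d\<bar>}" using d by (auto dest: dvd_imp_le_int)
  thus ?thesis by (rule finite_subset) auto
qed

section \<open>Computing with classes of families of reductions\<close>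

locale finite_czv = primitive_root N \<xi> for N :: nat and \<xi> :: complex +
  fixes L :: "nat \<Rightarrow> 'a ring" and x :: "nat \<Rightarrow> 'a"
  assumes closure_L: "p \<in> primes_minus1 N \<Longrightarrow> alg_closure_of_prime_field p (L p)"
    and root_x: "p \<in> primes_minus1 N \<Longrightarrow> primitive_unity_root (L p) N (x p)"
begin

abbreviation "red_at p \<equiv> root_reduction.red \<xi> (L p) p (x p)"
abbreviation "loc_at p \<equiv> root_reduction.loc \<xi> p"
abbreviation "\<A> \<equiv> A_ring N L x"
abbreviation "cls \<equiv> A_class N L x"
abbreviation "res_ring p \<equiv> prime_field_adjoin (L p) N (x p)"

lemma prime_p: "p \<in> primes_minus1 N \<Longrightarrow> Factorial_Ring.prime p"
  by (simp add: primes_minus1_def)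

lemma reduction: "p \<in> primes_minus1 N \<Longrightarrow> root_reduction N \<xi> (L p) p (x p)"
proof -
  assume p: "p \<in> primes_minus1 N"
  note cl = alg_closure_of_prime_fieldD[OF closure_L[OF p] prime_p[OF p]]
  show ?thesis
    using root_x[OF p] cl prime_p[OF p] primitive_root_axioms
    by (intro root_reduction.intro root_reduction_axioms.intro) (auto simp: primitive_unity_root_def)
qed

lemma ring_res: "p \<in> primes_minus1 N \<Longrightarrow> ring (res_ring p)"
  using root_reduction.ring_adjoin[OF reduction] .

lemma res_simps [simp]:
  "add (res_ring p) = add (L p)" "monoid.mult (res_ring p) = monoid.mult (L p)"
  "\<zero>\<^bsub>res_ring p\<^esub> = \<zero>\<^bsub>L p\<^esub>"  "\<one>\<^bsub>res_ring p\<^esub> = \<one>\<^bsub>L p\<^esub>"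
  by (simp_all add: prime_field_adjoin_def)

text \<open>Nothing is asked at other indices because \<open>A_class\<close> restricts families to
  \<open>primes_minus1 N\<close>.\<close>

definition components :: "(nat \<Rightarrow> 'a) set" where
  "components = {f. \<forall>p\<in>primes_minus1 N. f p \<in> carrier (res_ring p)}"

lemma restrict_in_carrier:
  "f \<in> components \<Longrightarrow> restrict f (primes_minus1 N) \<in> carrier (A_prod N L x)"
  by (auto simp: components_def A_prod_def product_ring_def)

lemma ideal_A: "ideal (A_ideal N L x) (A_prod N L x)"
  unfolding A_ideal_def A_prod_def by (intro ideal_direct_sum ring_res)

lemma cls_hom: "(+>\<^bsub>A_prod N L x\<^esub>) (A_ideal N L x) \<in> ring_hom (A_prod N L x) \<A>"
  unfolding A_ring_def by (rule ideal.rcos_ring_hom[OF ideal_A])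

lemma ring_A: "ring \<A>"
  unfolding A_ring_def by (rule ideal.quotient_is_ring[OF ideal_A])

lemma cls_closed: "f \<in> components \<Longrightarrow> cls f \<in> carrier \<A>"
  unfolding A_class_def by (rule ring_hom_closed[OF cls_hom restrict_in_carrier])

lemma cls_add:
  assumes "f \<in> components" "g \<in> components"
  shows "cls f \<oplus>\<^bsub>\<A>\<^esub> cls g = cls (\<lambda>p. f p \<oplus>\<^bsub>L p\<^esub> g p)"
proof -
  have "(\<lambda>p\<in>primes_minus1 N. f p \<oplus>\<^bsub>L p\<^esub> g p) =
     restrict f (primes_minus1 N) \<oplus>\<^bsub>A_prod N L x\<^esub> restrict g (primes_minus1 N)"
    by (auto simp: A_prod_def product_ring_def)
  thus ?thesis unfolding A_class_def
    using ring_hom_add[OF cls_hom assms[THEN restrict_in_carrier]] by simp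
qed

lemma cls_mult:
  assumes "f \<in> components" "g \<in> components"
  shows "cls f \<otimes>\<^bsub>\<A>\<^esub> cls g = cls (\<lambda>p. f p \<otimes>\<^bsub>L p\<^esub> g p)"
proof -
  have "(\<lambda>p\<in>primes_minus1 N. f p \<otimes>\<^bsub>L p\<^esub> g p) =
     restrict f (primes_minus1 N) \<otimes>\<^bsub>A_prod N L x\<^esub> restrict g (primes_minus1 N)"
    by (auto simp: A_prod_def product_ring_def)
  thus ?thesis unfolding A_class_def
    using ring_hom_mult[OF cls_hom assms[THEN restrict_in_carrier]] by simp
qed

lemma cls_zero: "cls (\<lambda>p. \<zero>\<^bsub>L p\<^esub>) = \<zero>\<^bsub>\<A>\<^esub>"
proof -
  interpret ideal "A_ideal N L x" "A_prod N L x" by (rule ideal_A)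
  have "(\<lambda>p\<in>primes_minus1 N. \<zero>\<^bsub>L p\<^esub>) = \<zero>\<^bsub>A_prod N L x\<^esub>"
    by (auto simp: A_prod_def product_ring_def)
  thus ?thesis unfolding A_class_def
    using ring_hom_zero[OF cls_hom ring_axioms ring_A] by simp
qed

text \<open>The difference of the families is supported on the finite exceptional set, so it lies in
  the direct sum and its class is zero.\<close>

lemma cls_eqI:
  assumes "f \<in> components" "g \<in> components" "finite {p \<in> primes_minus1 N. f p \<noteq> g p}"
  shows "cls f = cls g"
proof -
  interpret ideal "A_ideal N L x" "A_prod N L x" by (rule ideal_A)
  note [simp] = ring.ring_simprules[OF ring_res, simplified]
  let ?P = "primes_minus1 N"
  let ?F = "restrict f ?P" and ?G = "restrict g ?P"
  let ?D = "\<lambda>p\<in>?P. f p \<oplus>\<^bsub>L p\<^esub> \<ominus>\<^bsub>res_ring p\<^esub> g p"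
  have D: "?D \<in> carrier (A_prod N L x)"
    using assms(1,2) by (auto simp: A_prod_def product_ring_def components_def)
  have "f p \<oplus>\<^bsub>L p\<^esub> \<ominus>\<^bsub>res_ring p\<^esub> g p = \<zero>\<^bsub>L p\<^esub>" if "p \<in> ?P" "f p = g p" for p
    using that assms(2) ring.ring_simprules(16)[OF ring_res, of p "g p", simplified]
    by (simp add: components_def)
  hence "{p\<in>?P. ?D p \<noteq> \<zero>\<^bsub>res_ring p\<^esub>} \<subseteq> {p\<in>?P. f p \<noteq> g p}"
    by auto
  hence "finite {p\<in>?P. ?D p \<noteq> \<zero>\<^bsub>res_ring p\<^esub>}" using assms(3) by (rule finite_subset)
  hence DI: "?D \<in> A_ideal N L x" using D by (simp add: A_ideal_def A_prod_def direct_sum_def)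
  have "?F = ?D \<oplus>\<^bsub>A_prod N L x\<^esub> ?G"
    using assms(1,2) by (auto simp: A_prod_def product_ring_def components_def fun_eq_iff)
  hence "A_ideal N L x +>\<^bsub>A_prod N L x\<^esub> ?F =
         (A_ideal N L x +>\<^bsub>A_prod N L x\<^esub> ?D) \<oplus>\<^bsub>\<A>\<^esub> (A_ideal N L x +>\<^bsub>A_prod N L x\<^esub> ?G)"
    using ring_hom_add[OF cls_hom D restrict_in_carrier[OF assms(2)]] by simp
  also have "A_ideal N L x +>\<^bsub>A_prod N L x\<^esub> ?D = \<zero>\<^bsub>\<A>\<^esub>"
    by (subst a_rcos_const[OF DI]) (simp add: A_ring_def FactRing_def)
  also have "\<zero>\<^bsub>\<A>\<^esub> \<oplus>\<^bsub>\<A>\<^esub> (A_ideal N L x +>\<^bsub>A_prod N L x\<^esub> ?G) = A_ideal N L x +>\<^bsub>A_prod N L x\<^esub> ?G"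
    using cls_closed[OF assms(2)] ring.ring_simprules(8)[OF ring_A] by (simp add: A_class_def)
  finally show ?thesis unfolding A_class_def .
qed

lemma red_closed_res: "p \<in> primes_minus1 N \<Longrightarrow> red_at p z \<in> carrier (res_ring p)"
  using root_reduction.red_in_adjoin[OF reduction] .

lemma red_components: "(\<lambda>p. red_at p (z p)) \<in> components"
  by (simp add: components_def red_closed_res)

text \<open>Only primes dividing one fixed denominator can fail.\<close>

lemma loc_cofinite:
  assumes "z \<in> rational_span"
  shows "finite {p \<in> primes_minus1 N. z \<notin> loc_at p}"
proof -
  from assms obtain g d where *: "d \<noteq> 0" "of_int d * z = poly (cpoly g) \<xi>" by (auto simp: rational_span_def)
  have "{p \<in> primes_minus1 N. z \<notin> loc_at p} \<subseteq> {p. int p dvd d}"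
    using *(2) root_reduction.loc_def[OF reduction] by auto
  thus ?thesis using finite_dvd[OF *(1)] by (rule finite_subset)
qed

lemma rat_mod_eq_red:
  assumes "p \<in> primes_minus1 N" "\<not> int p dvd snd (quotient_of a)"
  shows "rat_mod (L p) p a = red_at p (of_rat a)" "of_rat a \<in> loc_at p"
proof -
  interpret root_reduction N \<xi> "L p" p "x p" by (rule reduction) fact
  obtain n d where nd: "quotient_of a = (n, d)" by force
  hence "a = of_int n / of_int d" by (rule quotient_of_div)
  hence a: "of_rat a = (of_int n / of_int d :: complex)" by (simp add: of_rat_divide)
  show "rat_mod (L p) p a = red_at p (of_rat a)" "of_rat a \<in> loc_at p"
    using assms(2) nd unfolding a rat_mod_def
    by (auto simp: red_divide loc_divide loc_of_int red_of_int)
qed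

text \<open>Every representation of \<open>z\<close> reduces to \<open>red_at p z\<close> at the
  primes dividing none of its denominators. Hence all representations give one class, and the
  definite description is justified.\<close>

lemma A_embed_eq:
  assumes "z \<in> rational_span"
  shows "A_embed N \<xi> L x z = cls (\<lambda>p. red_at p z)"
proof -
  let ?f = "\<lambda>a p. \<Oplus>\<^bsub>L p\<^esub>j\<in>{..<N}. rat_mod (L p) p (a j) \<otimes>\<^bsub>L p\<^esub> (x p [^]\<^bsub>L p\<^esub> j)"
  have *: "cls (?f a) = cls (\<lambda>p. red_at p z)"
    if z: "z = (\<Sum>j<N. of_rat (a j) * \<xi> ^ j)" for a :: "nat \<Rightarrow> rat"
  proof -
    let ?B = "\<Union>j<N. {p. int p dvd snd (quotient_of (a j))}"
    have fin: "finite ?B" using quotient_of_denom_pos'[of "a _"] by (intro finite_UN_I finite_dvd) (auto simp: less_le)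
    have eq: "?f a p = red_at p z" if p: "p \<in> primes_minus1 N" "p \<notin> ?B" for p
    proof -
      interpret root_reduction N \<xi> "L p" p "x p" by (rule reduction) fact
      have loc: "of_rat (a j) \<in> loc_at p" "rat_mod (L p) p (a j) = red_at p (of_rat (a j))" if "j < N" for j
        using that p rat_mod_eq_red[of p "a j"] by auto
      have "red_at p z = (\<Oplus>\<^bsub>L p\<^esub>j\<in>{..<N}. red_at p (of_rat (a j) * \<xi> ^ j))"
        unfolding z using loc by (intro red_sum) (auto intro: loc_mult loc_power loc_root)
      also have "\<dots> = ?f a p"
        using loc by (intro finsum_cong') (auto simp: red_mult loc_power loc_root red_power red_root)
      finally show ?thesis by simp
    qed
    have "?f a \<in> components"
      unfolding components_def
    proof safe
      fix p assume p: "p \<in> primes_minus1 N"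
      interpret root_reduction N \<xi> "L p" p "x p" by (rule reduction) fact
      \<comment> \<open>At a prime dividing its denominator a coefficient is read as zero. With
        those coefficients replaced by 0 the sum is still a reduction, so it stays in the carrier at
        every prime.\<close>
      let ?a = "\<lambda>j. if int p dvd snd (quotient_of (a j)) then 0 else a j"
      have rm: "rat_mod (L p) p (a j) = red_at p (of_rat (?a j))" "of_rat (?a j) \<in> loc_at p" for j
        using rat_mod_eq_red[OF p, of "a j"]
        by (auto simp: rat_mod_def split: prod.splits)
      have "?f a p = (\<Oplus>\<^bsub>L p\<^esub>j\<in>{..<N}. red_at p (of_rat (?a j) * \<xi> ^ j))"
        by (intro finsum_cong')
           (auto simp: rm red_mult loc_power loc_root red_power red_root simp del: of_rat_0)
      also have "\<dots> = red_at p (\<Sum>j<N. of_rat (?a j) * \<xi> ^ j)"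
        by (rule red_sum[symmetric], rule finite_lessThan, rule loc_mult[OF rm(2) loc_power[OF loc_root]])
      finally show "?f a p \<in> carrier (res_ring p)" by (simp only: red_in_adjoin)
    qed
    thus ?thesis using eq
      by (intro cls_eqI red_components finite_subset[OF _ fin]) auto
  qed
  obtain a :: "nat \<Rightarrow> rat" where a: "z = (\<Sum>j<N. of_rat (a j) * \<xi> ^ j)"
    using rational_span_representation[OF assms] by blast
  show ?thesis unfolding A_embed_def
  proof (rule the_equality)
    show "\<exists>a. z = (\<Sum>j<N. of_rat (a j) * \<xi> ^ j) \<and> cls (\<lambda>p. red_at p z) = cls (?f a)"
      using a *[OF a] by (intro exI[of _ a] conjI) (rule a, rule sym)
    fix c assume "\<exists>a. z = (\<Sum>j<N. of_rat (a j) * \<xi> ^ j) \<and> c = cls (?f a)"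
    then obtain b where "z = (\<Sum>j<N. of_rat (b j) * \<xi> ^ j)" "c = cls (?f b)" by blast
    with *[of b] show "c = cls (\<lambda>p. red_at p z)" by simp
  qed
qed

end

section \<open>Words and power series\<close>

text \<open>The linear functional with values \<open>F\<close> on words; since it turns
  \<open>lin_ext\<close> into composition, concatenation, shuffle, \<open>q_map\<close> and
  \<open>tau\<close> are all handled through it.\<close>

definition pairing :: "('w \<Rightarrow> complex) \<Rightarrow> ('w \<Rightarrow>\<^sub>0 complex) \<Rightarrow> complex" where
  "pairing F u = (\<Sum>w\<in>Poly_Mapping.keys u. Poly_Mapping.lookup u w * F w)"

lemma pairing_superset:
  assumes "finite W" "Poly_Mapping.keys u \<subseteq> W"
  shows "pairing F u = (\<Sum>w\<in>W. Poly_Mapping.lookup u w * F w)"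
  unfolding pairing_def using assms by (intro sum.mono_neutral_left) (auto simp: in_keys_iff)

lemma pairing_0 [simp]: "pairing F 0 = 0"
  by (simp add: pairing_def)

lemma pairing_single [simp]: "pairing F (Poly_Mapping.single w c) = c * F w"
  by (simp add: pairing_def)

lemma pairing_add: "pairing F (u + v) = pairing F u + pairing F v"
proof -
  have k: "Poly_Mapping.keys (u + v) \<subseteq> Poly_Mapping.keys u \<union> Poly_Mapping.keys v"
    by (rule keys_add)
  show ?thesis
    by (subst (1 2 3) pairing_superset[of "Poly_Mapping.keys u \<union> Poly_Mapping.keys v"])
       (use k in \<open>auto simp: lookup_add algebra_simps sum.distrib\<close>)
qed

lemma pairing_sum: "pairing F (\<Sum>i\<in>A. f i) = (\<Sum>i\<in>A. pairing F (f i))"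
  by (induction A rule: infinite_finite_induct) (simp_all add: pairing_add)

lemma lookup_map_times [simp]:
  "Poly_Mapping.lookup (Poly_Mapping.map ((*) c) u) w = c * Poly_Mapping.lookup u w" for c :: complex
  by (simp add: Poly_Mapping.map.rep_eq when_def)

lemma pairing_map_times: "pairing F (Poly_Mapping.map ((*) c) u) = c * pairing F u"
proof -
  have k: "Poly_Mapping.keys (Poly_Mapping.map ((*) c) u) \<subseteq> Poly_Mapping.keys u"
    by (auto simp: in_keys_iff)
  show ?thesis
    by (subst (1 2) pairing_superset[of "Poly_Mapping.keys u"])
       (use k in \<open>auto simp: sum_distrib_left mult.assoc\<close>)
qed

lemma pairing_lin_ext: "pairing F (lin_ext f u) = pairing (\<lambda>w. pairing F (f w)) u"
  unfolding lin_ext_def by (simp add: pairing_sum pairing_map_times) (simp add: pairing_def)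

lemma pairing_conc: "pairing F (conc u v) = pairing (\<lambda>a. pairing (\<lambda>b. F (a @ b)) v) u"
  by (simp add: conc_def bilin_ext_def pairing_lin_ext)

lemma pairing_letter_conc:
  "pairing F (conc (Poly_Mapping.single [a] 1) u) = pairing (\<lambda>w. F (a # w)) u"
  by (simp add: pairing_conc)

lemma pairing_linear:
  "pairing (\<lambda>w. \<Sum>i\<in>A. c i * F i w) u = (\<Sum>i\<in>A. c i * pairing (F i) u)"
  unfolding pairing_def sum_distrib_left by (subst sum.swap) (simp add: mult_ac)

text \<open>Coefficients are themselves functionals, so facts about \<open>pairing\<close> also
  describe the coefficients of a linear extension.\<close>

lemma lookup_eq_pairing: "Poly_Mapping.lookup u w = pairing (\<lambda>w'. if w' = w then 1 else 0) u"
  by (subst pairing_superset[of "insert w (Poly_Mapping.keys u)"]) (auto simp: if_distrib sum.delta cong: if_cong)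

lemma lookup_lin_ext:
  "Poly_Mapping.lookup (lin_ext f u) w = pairing (\<lambda>v. Poly_Mapping.lookup (f v) w) u"
  by (simp add: lookup_eq_pairing[of _ w] pairing_lin_ext)

lemma keys_lin_ext: "Poly_Mapping.keys (lin_ext f u) \<subseteq> (\<Union>w\<in>Poly_Mapping.keys u. Poly_Mapping.keys (f w))"
proof
  fix w assume "w \<in> Poly_Mapping.keys (lin_ext f u)"
  hence "pairing (\<lambda>v. Poly_Mapping.lookup (f v) w) u \<noteq> 0" by (simp add: in_keys_iff lookup_lin_ext)
  then obtain v where "v \<in> Poly_Mapping.keys u" "Poly_Mapping.lookup (f v) w \<noteq> 0"
    unfolding pairing_def by (metis (no_types, lifting) mult_zero_right sum.neutral)
  thus "w \<in> (\<Union>w\<in>Poly_Mapping.keys u. Poly_Mapping.keys (f w))" by (auto simp: in_keys_iff)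
qed

lemma lookup_letter_conc:
  "Poly_Mapping.lookup (conc (Poly_Mapping.single [a] 1) u) w =
     (if w \<noteq> [] \<and> hd w = a then Poly_Mapping.lookup u (tl w) else 0)"
proof (cases w)
  case Nil
  have "Poly_Mapping.lookup (conc (Poly_Mapping.single [a] 1) u) [] = 0"
    by (subst lookup_eq_pairing, subst pairing_letter_conc) (simp add: pairing_def)
  with Nil show ?thesis by simp
next
  case (Cons b w')
  have "Poly_Mapping.lookup (conc (Poly_Mapping.single [a] 1) u) (b # w') =
     pairing (\<lambda>v. if a # v = b # w' then 1 else 0) u"
    by (subst lookup_eq_pairing, subst pairing_letter_conc) (rule refl)
  also have "\<dots> = (if a = b then Poly_Mapping.lookup u w' else 0)"
    by (cases "a = b") (simp add: lookup_eq_pairing[of u], simp add: pairing_def)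
  finally show ?thesis using Cons by auto
qed

text \<open>Integrality keeps the coefficients of shuffles inside
  \<open>rational_span\<close>.\<close>

lemma lookup_shuffle_words_Ints: "Poly_Mapping.lookup (shuffle_words u v) w \<in> \<int>"
  by (induction u v arbitrary: w rule: shuffle_words.induct)
     (auto simp: lookup_single when_def lookup_add lookup_letter_conc simp del: One_nat_def)

lemma keys_shuffle_words:
  "w \<in> Poly_Mapping.keys (shuffle_words u v) \<Longrightarrow> u \<in> words1 S \<Longrightarrow> v \<in> words1 S \<Longrightarrow> w \<in> words1 S"
proof (induction u v arbitrary: w rule: shuffle_words.induct)
  case (3 a u b v)
  \<comment> \<open>With a nonempty tail, prefixing a letter leaves the last letter
    unchanged.\<close>
  have nil: "[] \<notin> Poly_Mapping.keys (shuffle_words u' v')" if "u' \<noteq> [] \<or> v' \<noteq> []" for u' v'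
    using that by (induction u' v' rule: shuffle_words.induct)
      (auto simp: in_keys_iff lookup_single lookup_add lookup_letter_conc)
  from 3 have uv: "u \<in> words1 S" "v \<in> words1 S" "a \<in> S" "b \<in> S"
    by (auto simp: words1_def split: if_splits)
  from 3(3) have "w \<noteq> [] \<and> (hd w = a \<and> tl w \<in> Poly_Mapping.keys (shuffle_words u (b # v)) \<or>
       hd w = b \<and> tl w \<in> Poly_Mapping.keys (shuffle_words (a # u) v))"
    by (auto simp: in_keys_iff lookup_add lookup_letter_conc split: if_splits)
  then obtain c w' where w: "w = c # w'" and c: "c = a \<and> w' \<in> Poly_Mapping.keys (shuffle_words u (b # v)) \<or>
       c = b \<and> w' \<in> Poly_Mapping.keys (shuffle_words (a # u) v)"
    by (cases w) auto
  hence "w' \<in> words1 S" "c \<in> S" using 3 uv by auto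
  moreover have "w' \<noteq> []" using c nil by auto
  ultimately show ?case by (simp add: w words1_def)
qed (auto simp: in_keys_iff lookup_single when_def split: if_splits)

section \<open>Power series of iterated integrals\<close>

text \<open>The expansion of \<open>a t / (1 - a t)\<close>: the differential form of the letter
  \<open>a\<close> with \<open>dt / t\<close> factored out.\<close>

definition geometric :: "complex \<Rightarrow> complex fps" where
  "geometric a = Abs_fps (\<lambda>k. if k = 0 then 0 else a ^ k)"

definition letter_op :: "complex \<Rightarrow> complex fps \<Rightarrow> complex fps" where
  "letter_op a f = (if a = 0 then f else geometric a * f)"

text \<open>Dividing the \<open>k\<close>th coefficient by \<open>k\<close> integrates against
  \<open>dt / t\<close> from 0; at \<open>k = 0\<close> division by zero yields the constant term
  0.\<close>

fun word_series :: "complex list \<Rightarrow> complex fps" where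
  "word_series [] = 1"
| "word_series (a # w) = Abs_fps (\<lambda>k. letter_op a (word_series w) $ k / of_nat k)"

lemma word_series_nth_0: "w \<noteq> [] \<Longrightarrow> word_series w $ 0 = 0"
  by (cases w) simp_all

text \<open>The derivation \<open>t d/dt\<close> undoes the integration if no constant term was
  lost; the hypothesis excludes the word \<open>[0]\<close>, whose integrand is the constant
  1.\<close>

lemma XD_word_series:
  assumes "a \<noteq> 0 \<or> w \<noteq> []"
  shows "fps_XD (word_series (a # w)) = letter_op a (word_series w)"
proof (rule fps_ext)
  fix k
  show "fps_XD (word_series (a # w)) $ k = letter_op a (word_series w) $ k"
    using assms by (cases "k = 0") (auto simp: letter_op_def geometric_def word_series_nth_0)
qed

lemma fps_XD_mult: "fps_XD (f * g) = fps_XD f * g + f * fps_XD g" for f g :: "complex fps"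
  by (simp add: fps_XD_def algebra_simps)

lemma letter_op_mult: "letter_op a f * g = letter_op a (f * g)" "f * letter_op a g = letter_op a (f * g)"
  by (simp_all add: letter_op_def mult_ac)

lemma pairing_letter_op:
  assumes "\<And>k. pairing (\<lambda>w. word_series w $ k) u = g $ k"
  shows "pairing (\<lambda>w. letter_op a (word_series w) $ k) u = letter_op a g $ k"
  using assms by (simp add: letter_op_def fps_mult_nth pairing_linear)

text \<open>Leibniz rule: \<open>fps_XD\<close> of the product of the two series splits into the two
  summands of the shuffle recursion, and it determines all coefficients but the constant one, which
  is zero on both sides when both words are nonempty.\<close>

lemma word_series_shuffle:
  assumes "u = [] \<or> last u \<noteq> 0" "v = [] \<or> last v \<noteq> 0"
  shows "pairing (\<lambda>w. word_series w $ k) (shuffle_words u v) = (word_series u * word_series v) $ k"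
  using assms
proof (induction u v arbitrary: k rule: shuffle_words.induct)
  case (3 a u b v)
  let ?A = "shuffle_words u (b # v)" and ?B = "shuffle_words (a # u) v"
  let ?a = "word_series (a # u)" and ?b = "word_series (b # v)"
  show ?case
  proof (cases "k = 0")
    case True
    then show ?thesis
      by (simp add: pairing_add pairing_letter_conc) (simp add: pairing_def)
  next
    case False
    have IH: "pairing (\<lambda>w. word_series w $ k) ?A = (word_series u * ?b) $ k"
        "pairing (\<lambda>w. word_series w $ k) ?B = (?a * word_series v) $ k" for k
      using 3 by (auto split: if_splits)
    have div: "pairing (\<lambda>w. F w / of_nat k) U = pairing F U / of_nat k" for F and U :: ncpoly
      by (simp add: pairing_def sum_divide_distrib)
    have "pairing (\<lambda>w. word_series w $ k) (shuffle_words (a # u) (b # v)) =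
       (letter_op a (word_series u * ?b) $ k + letter_op b (?a * word_series v) $ k) / of_nat k"
      by (simp add: pairing_add pairing_letter_conc div pairing_letter_op[OF IH(1)] pairing_letter_op[OF IH(2)]
           add_divide_distrib del: word_series.simps(2)) (simp add: div pairing_letter_op[OF IH(1)] pairing_letter_op[OF IH(2)]
           add_divide_distrib)
    also have "letter_op a (word_series u * ?b) + letter_op b (?a * word_series v) = fps_XD (?a * ?b)"
      using 3(3,4) unfolding fps_XD_mult
      by (subst (1 2) XD_word_series) (auto simp only: letter_op_mult last.simps split: if_splits)
    hence "letter_op a (word_series u * ?b) $ k + letter_op b (?a * word_series v) $ k = of_nat k * (?a * ?b) $ k"
      by (metis fps_add_nth fps_XD_nth)
    finally show ?thesis using False by simp
  qed
qed simp_all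

text \<open>The series evaluated at \<open>t = 1\<close> and truncated.\<close>

definition word_sum :: "nat \<Rightarrow> complex list \<Rightarrow> complex" where
  "word_sum n w = (\<Sum>k<n. word_series w $ k)"

lemma word_sum_shuffle:
  assumes "u = [] \<or> last u \<noteq> 0" "v = [] \<or> last v \<noteq> 0"
  shows "pairing (word_sum n) (shuffle_words u v) = (\<Sum>k<n. (word_series u * word_series v) $ k)"
  unfolding word_sum_def
  using pairing_linear[of "\<lambda>_. 1" "\<lambda>k w. word_series w $ k"] word_series_shuffle[OF assms] by simp

lemma word_series_zeros:
  "word_series (replicate m 0 @ a # w) $ k = word_series (a # w) $ k / of_nat k ^ m"
proof (induction m)
  case (Suc m)
  have "word_series (replicate (Suc m) 0 @ a # w) $ k = word_series (replicate m 0 @ a # w) $ k / of_nat k"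
    by (simp add: letter_op_def)
  thus ?case unfolding Suc by simp
qed simp

text \<open>For \<open>a = 1\<close> the right side is a partial sum of the series of
  \<open>w\<close>, so prefixing the letter 1 turns truncated sums into coefficients.\<close>

lemma word_series_Cons_nth:
  assumes "a \<noteq> 0"
  shows "of_nat k * word_series (a # w) $ k = (\<Sum>j<k. a ^ (k - j) * word_series w $ j)"
proof (cases "k = 0")
  case False
  have "of_nat k * word_series (a # w) $ k = (\<Sum>j=0..k. word_series w $ j * geometric a $ (k - j))"
    using False assms by (simp add: letter_op_def mult.commute[of "geometric a"] fps_mult_nth)
  also have "\<dots> = (\<Sum>j<k. word_series w $ j * geometric a $ (k - j))"
    by (rule sum.mono_neutral_right) (auto simp: geometric_def)
  also have "\<dots> = (\<Sum>j<k. a ^ (k - j) * word_series w $ j)"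
    by (rule sum.cong) (auto simp: geometric_def)
  finally show ?thesis .
qed simp

lemma sum_fps_mult_nth:
  fixes f g :: "'a::comm_semiring_1 fps"
  shows "(\<Sum>n<N. (f * g) $ n) = (\<Sum>i<N. f $ i * (\<Sum>j<N-i. g $ j))"
proof -
  have "(\<Sum>n<N. (f * g) $ n) = (\<Sum>n<N. \<Sum>i\<le>n. f $ i * g $ (n - i))"
    by (simp add: fps_mult_nth atLeast0AtMost)
  also have "\<dots> = (\<Sum>(i, j) | i + j < N. f $ i * g $ j)"
    by (rule sum.triangle_reindex[symmetric])
  also have "{(i, j). i + j < N} = (SIGMA i:{..<N}. {..<N-i})" by auto
  also have "(\<Sum>(i, j)\<in>(SIGMA i:{..<N}. {..<N-i}). f $ i * g $ j) = (\<Sum>i<N. \<Sum>j<N-i. f $ i * g $ j)"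
    by (rule sum.Sigma[symmetric]) auto
  finally show ?thesis by (simp add: sum_distrib_left)
qed

text \<open>For fixed \<open>i\<close> the coefficients of \<open>v\<close> are summed below
  \<open>p - i\<close>, which is \<open>p - i\<close> times a coefficient of \<open>1 # v\<close>;
  the leading zeros of the other word contribute \<open>1 / i ^ m\<close>.\<close>

lemma sum_series_product:
  "(\<Sum>n<p. (word_series (replicate m 0 @ 1 # u) * word_series v) $ n) =
   (\<Sum>i\<in>{0<..<p}. word_series (1 # u) $ i * word_series (1 # v) $ (p - i) * (of_nat (p - i) / of_nat i ^ m))"
proof -
  have "(\<Sum>n<p. (word_series (replicate m 0 @ 1 # u) * word_series v) $ n) =
    (\<Sum>i<p. word_series (replicate m 0 @ 1 # u) $ i * (of_nat (p - i) * word_series (1 # v) $ (p - i)))"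
    unfolding sum_fps_mult_nth by (subst word_series_Cons_nth) simp_all
  \<comment> \<open>The term \<open>i = 0\<close> vanishes because the word is nonempty.\<close>
  also have "\<dots> = (\<Sum>i\<in>{0<..<p}. word_series (replicate m 0 @ 1 # u) $ i * (of_nat (p - i) * word_series (1 # v) $ (p - i)))"
    by (rule sum.mono_neutral_right) (auto simp: word_series_nth_0)
  also have "\<dots> = (\<Sum>i\<in>{0<..<p}. word_series (1 # u) $ i * word_series (1 # v) $ (p - i) * (of_nat (p - i) / of_nat i ^ m))"
    unfolding word_series_zeros by (intro sum.cong refl) (simp add: mult_ac del: word_series.simps)
  finally show ?thesis .
qed

section \<open>Moving factors across a product modulo \<open>p\<close>\<close>

context root_reduction
begin

lemma not_dvd_less: "0 < i \<Longrightarrow> i < p \<Longrightarrow> \<not> int p dvd int i"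
  by (auto dest: dvd_imp_le)

text \<open>Coefficients below \<open>p\<close> involve divisions by positive integers below
  \<open>p\<close> only; at index 0 division by zero returns 0.\<close>

lemma word_series_loc:
  assumes "set w \<subseteq> loc" "k < p"
  shows "word_series w $ k \<in> loc"
  using assms
proof (induction w arbitrary: k)
  case Nil
  show ?case by simp
next
  case (Cons a w)
  have "letter_op a (word_series w) $ k \<in> loc"
    using Cons by (auto simp: letter_op_def fps_mult_nth geometric_def intro!: loc_sum loc_mult loc_power)
  thus ?case using loc_divide[of _ "int k"] not_dvd_less[of k] Cons.prems by (cases "k = 0") auto
qed

lemma word_sum_loc: "set w \<subseteq> loc \<Longrightarrow> word_sum p w \<in> loc"
  unfolding word_sum_def by (intro loc_sum word_series_loc) auto

lemma series_product_exchange: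
  assumes "set u \<subseteq> loc" "set v \<subseteq> loc"
  shows "\<exists>z\<in>loc. (\<Sum>n<p. (word_series (replicate m 0 @ 1 # u) * word_series v) $ n) -
     (-1) ^ Suc m * (\<Sum>n<p. (word_series (replicate m 0 @ 1 # v) * word_series u) $ n) = of_nat p * z"
proof -
  let ?A = "\<lambda>i. word_series (1 # u) $ i" and ?B = "\<lambda>i. word_series (1 # v) $ i"
  \<comment> \<open>An exact quotient, because \<open>(p - i) - (- i) = p\<close> divides the
    difference of the powers; it makes the factor \<open>p\<close> explicit.\<close>
  define c where "c i = ((int p - int i) ^ Suc m - (- int i) ^ Suc m) div int p" for i
  let ?Z = "\<Sum>i\<in>{0<..<p}. ?A i * ?B (p - i) * (of_int (c i) / of_int ((int i * int (p - i)) ^ m))"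
  have c: "int p * c i = (int p - int i) ^ Suc m - (- int i) ^ Suc m" for i
    unfolding c_def using power_diff_sumr2[of "int p - int i" "Suc m" "- int i"]
    by (intro dvd_mult_div_cancel) (simp del: power_Suc)
  have weight: "of_nat (p - i) / of_nat i ^ m - (-1) ^ Suc m * (of_nat i / of_nat (p - i) ^ m) =
      (of_nat p * (of_int (c i) / of_int ((int i * int (p - i)) ^ m)) :: complex)" if i: "i \<in> {0<..<p}" for i
  proof -
    have "(of_nat p * of_int (c i) :: complex) = of_nat (p - i) ^ Suc m - (- of_nat i) ^ Suc m"
      using arg_cong[OF c[of i], of "of_int :: int \<Rightarrow> complex"] i by (simp add: of_nat_diff)
    moreover have "a / b ^ m - (-1) ^ Suc m * (b / a ^ m) = P * (C / (b * a) ^ m)"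
      if "P * C = a ^ Suc m - (- b) ^ Suc m" "a \<noteq> 0" "b \<noteq> 0" for a b P C :: complex
    proof -
      have "P * (C / (b * a) ^ m) = (a ^ Suc m - (- b) ^ Suc m) / (b * a) ^ m"
        by (simp only: times_divide_eq_right that(1))
      also have "\<dots> = (a * a ^ m - (-1) ^ Suc m * (b * b ^ m)) / (b ^ m * a ^ m)"
        by (simp add: power_minus[of b] power_mult_distrib)
      also have "\<dots> = a / b ^ m - (-1) ^ Suc m * (b / a ^ m)"
        using that(2,3) by (simp add: diff_divide_distrib add_divide_distrib)
      finally show ?thesis ..
    qed
    ultimately show ?thesis using i by simp
  qed
  \<comment> \<open>The substitution \<open>i \<mapsto> p - i\<close> gives both sums the same
    products of coefficients; only the weights differ.\<close>
  have "(\<Sum>n<p. (word_series (replicate m 0 @ 1 # v) * word_series u) $ n) =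
     (\<Sum>i\<in>{0<..<p}. ?A i * ?B (p - i) * (of_nat i / of_nat (p - i) ^ m))"
    unfolding sum_series_product
    by (rule sum.reindex_bij_witness[of _ "\<lambda>i. p - i" "\<lambda>i. p - i"]) auto
  hence "(\<Sum>n<p. (word_series (replicate m 0 @ 1 # u) * word_series v) $ n) -
     (-1) ^ Suc m * (\<Sum>n<p. (word_series (replicate m 0 @ 1 # v) * word_series u) $ n) =
     (\<Sum>i\<in>{0<..<p}. ?A i * ?B (p - i) *
        (of_nat (p - i) / of_nat i ^ m - (-1) ^ Suc m * (of_nat i / of_nat (p - i) ^ m)))"
    unfolding sum_series_product
    by (simp only: right_diff_distrib sum_subtractf sum_distrib_left mult.left_commute)
  also have "\<dots> = of_nat p * (\<Sum>i\<in>{0<..<p}. ?A i * ?B (p - i) * (of_int (c i) / of_int ((int i * int (p - i)) ^ m)))"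
    unfolding sum_distrib_left by (intro sum.cong refl, subst weight) (simp_all add: mult_ac del: word_series.simps)
  finally have eq: "(\<Sum>n<p. (word_series (replicate m 0 @ 1 # u) * word_series v) $ n) -
     (-1) ^ Suc m * (\<Sum>n<p. (word_series (replicate m 0 @ 1 # v) * word_series u) $ n) = of_nat p * ?Z" .
  have "?Z \<in> loc"
  proof -
    have "\<not> int p dvd (int i * int (p - i)) ^ m" if i: "i \<in> {0<..<p}" for i
    proof
      assume "int p dvd (int i * int (p - i)) ^ m"
      hence "int p dvd int i * int (p - i)" using prime_p prime_dvd_power[of "int p"] by simp
      moreover have "\<not> int p dvd int i * int (p - i)"
        using i by (intro not_dvd_mult not_dvd_less) auto
      ultimately show False by contradiction
    qed
    thus ?thesis
      using assms by (intro loc_sum loc_mult loc_divide word_series_loc loc_of_int) auto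
  qed
  with eq show ?thesis by blast
qed

text \<open>Each exchange strips the head of \<open>ys\<close> and puts it in front of
  \<open>v\<close>, so \<open>v\<close> is generalised; the factors arrive in reverse order and the
  signs multiply.\<close>

lemma series_product_reverse:
  assumes "ys \<in> lists ({1..} \<times> {1})" "set v \<subseteq> loc"
  shows "\<exists>z\<in>loc. (\<Sum>n<p. (word_series (y_word ys) * word_series v) $ n) -
     (-1) ^ sum_list (map fst ys) * word_sum p (y_word (rev ys) @ v) = of_nat p * z"
  using assms
proof (induction ys arbitrary: v rule: list.induct)
  case Nil
  show ?case by (intro bexI[of _ 0]) (simp_all add: word_sum_def)
next
  case (Cons y ys)
  have "y \<in> {1..} \<times> {1}" using Cons.prems(1) by simp
  then obtain s where "y = (s, 1)" "s \<ge> 1" by (cases y) simp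
  then obtain m where y: "y = (Suc m, 1)" by (cases s) auto
  let ?u = "y_word ys" and ?v = "replicate m 0 @ 1 # v"
  let ?s = "(-1) ^ sum_list (map fst ys) :: complex"
  have "set (y_word ys) \<subseteq> loc" if "ys \<in> lists ({1..} \<times> {1})" for ys
    using that by (induction ys rule: list.induct) auto
  hence u: "set ?u \<subseteq> loc" using Cons.prems by auto
  have v: "set ?v \<subseteq> loc" using Cons.prems by auto
  obtain z where z: "z \<in> loc" "(\<Sum>n<p. (word_series (replicate m 0 @ 1 # ?u) * word_series v) $ n) -
     (-1) ^ Suc m * (\<Sum>n<p. (word_series ?v * word_series ?u) $ n) = of_nat p * z"
    using series_product_exchange[OF u Cons.prems(2)] by blast
  obtain z' where z': "z' \<in> loc" "(\<Sum>n<p. (word_series ?u * word_series ?v) $ n) -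
     ?s * word_sum p (y_word (rev ys) @ ?v) = of_nat p * z'"
    using Cons.IH[OF _ v] Cons.prems(1) by auto
  \<comment> \<open>The head of \<open>ys\<close> is the last factor of the reversed word, hence
    adjacent to \<open>v\<close>.\<close>
  have rev: "y_word (rev (y # ys)) @ v = y_word (rev ys) @ ?v"
    by (simp add: y y_word_def)
  have "(\<Sum>n<p. (word_series (y_word (y # ys)) * word_series v) $ n) -
     (-1) ^ sum_list (map fst (y # ys)) * word_sum p (y_word (rev (y # ys)) @ v) =
     of_nat p * (z + (-1) ^ Suc m * z')"
    unfolding rev distrib_left mult.left_commute[of "of_nat p"] z(2)[symmetric] z'(2)[symmetric]
    by (simp add: y algebra_simps power_add mult.commute[of "word_series ?v"] del: word_series.simps)
  moreover have "z + (-1) ^ Suc m * z' \<in> loc"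
    using loc_of_int[of "-1"] z(1) z'(1) by (intro loc_add loc_mult loc_power) simp_all
  ultimately show ?case by blast
qed

end

section \<open>Truncated colored multiple zeta values\<close>

definition index_lists :: "nat \<Rightarrow> nat \<Rightarrow> nat list set" where
  "index_lists n p = {ks. length ks = n \<and> sorted_wrt (>) ks \<and> set ks \<subseteq> {0<..<p}}"

definition truncated_czv :: "nat \<Rightarrow> (nat \<times> complex) list \<Rightarrow> complex" where
  "truncated_czv p ys = (\<Sum>ks\<in>index_lists (length ys) p.
     \<Prod>j<length ys. snd (ys ! j) ^ (ks ! j) / of_nat (ks ! j) ^ fst (ys ! j))"

lemma finite_index_lists [simp]: "finite (index_lists n p)"
  by (rule finite_subset[OF _ finite_lists_length_eq[of "{0<..<p}" n]]) (auto simp: index_lists_def)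

lemma index_lists_0 [simp]: "index_lists 0 p = {[]}"
  by (auto simp: index_lists_def)

lemma index_lists_Suc:
  "index_lists (Suc n) p = (\<lambda>(k, ks). k # ks) ` (SIGMA k:{0<..<p}. index_lists n k)"
proof (intro equalityI subsetI)
  fix ks assume ks: "ks \<in> index_lists (Suc n) p"
  then obtain k ks' where "ks = k # ks'" by (cases ks) (auto simp: index_lists_def)
  with ks show "ks \<in> (\<lambda>(k, ks). k # ks) ` (SIGMA k:{0<..<p}. index_lists n k)"
    by (intro image_eqI[of _ _ "(k, ks')"]) (auto simp: index_lists_def)
qed (force simp: index_lists_def)

lemma truncated_czv_Nil [simp]: "truncated_czv p [] = 1"
  by (simp add: truncated_czv_def)

lemma truncated_czv_Cons:
  "truncated_czv p ((s, \<eta>) # ys) = (\<Sum>k\<in>{0<..<p}. \<eta> ^ k / of_nat k ^ s * truncated_czv k ys)"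
proof -
  have inj: "inj_on (\<lambda>(k, ks). k # ks) (SIGMA k:{0<..<p}. index_lists (length ys) k)"
    by (auto simp: inj_on_def)
  show ?thesis
    unfolding truncated_czv_def list.size(4) add_0_right add_Suc_right index_lists_Suc sum.reindex[OF inj]
    by (simp add: prod.lessThan_Suc_shift sum_distrib_left sum.Sigma split_def del: prod.lessThan_Suc)
qed

text \<open>\<open>q_factors\<close> with an arbitrary predecessor \<open>\<nu>\<close> of the first
  root, which makes recursion on the list possible.\<close>

fun quotient_factors :: "complex \<Rightarrow> (nat \<times> complex) list \<Rightarrow> (nat \<times> complex) list" where
  "quotient_factors \<nu> [] = []"
| "quotient_factors \<nu> ((s, \<eta>) # ys) = (s, \<eta> * inverse \<nu>) # quotient_factors \<eta> ys"

lemma length_quotient_factors [simp]: "length (quotient_factors \<nu> ys) = length ys"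
  by (induction \<nu> ys rule: quotient_factors.induct) simp_all

lemma nth_quotient_factors:
  "j < length ys \<Longrightarrow> quotient_factors \<nu> ys ! j =
     (fst (ys ! j), snd (ys ! j) * inverse (if j = 0 then \<nu> else snd (ys ! (j - 1))))"
  by (induction \<nu> ys arbitrary: j rule: quotient_factors.induct)
     (auto simp: nth_Cons split: nat.splits)

lemma q_factors_eq: "q_factors ys = quotient_factors 1 ys"
  by (rule nth_equalityI) (auto simp: q_factors_def nth_quotient_factors)

text \<open>In the series of the word the \<open>j\<close>th root has exponent
  \<open>k_j - k_(j+1)\<close>; collecting the powers with exponent \<open>k_j\<close> gives
  quotients of consecutive roots. The predecessor \<open>\<nu>\<close> appears as the weight
  \<open>1 / \<nu> ^ k\<close> on the outermost index.\<close>

lemma truncated_czv_quotient_factors: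
  assumes "ys \<in> lists ({1..} \<times> - {0})" "\<nu> \<noteq> 0" "p > 0"
  shows "truncated_czv p (quotient_factors \<nu> ys) = (\<Sum>k<p. word_series (y_word ys) $ k / \<nu> ^ k)"
  using assms
proof (induction \<nu> ys arbitrary: p rule: quotient_factors.induct)
  case (1 \<nu>)
  \<comment> \<open>The empty word has series 1, so only index 0 counts, and \<open>p > 0\<close>
    keeps it in range.\<close>
  have "(\<Sum>k<p. word_series (y_word []) $ k / \<nu> ^ k) = (\<Sum>k\<in>{0}. word_series (y_word []) $ k / \<nu> ^ k)"
    using 1 by (intro sum.mono_neutral_right) auto
  then show ?case by simp
next
  case (2 \<nu> s \<eta> ys)
  from 2 obtain m where s: "s = Suc m" and \<eta>: "\<eta> \<noteq> 0" by (cases s) auto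
  let ?W = "word_series (y_word ((s, \<eta>) # ys))"
  have W: "?W $ k = (\<Sum>j<k. \<eta> ^ (k - j) * word_series (y_word ys) $ j) / of_nat k ^ s" for k
  proof -
    have "?W $ k = (of_nat k * word_series (\<eta> # y_word ys) $ k) / of_nat k ^ s"
      by (simp add: s word_series_zeros word_series_nth_0 del: word_series.simps)
    thus ?thesis by (simp only: word_series_Cons_nth[OF \<eta>])
  qed
  have "truncated_czv p (quotient_factors \<nu> ((s, \<eta>) # ys)) =
     (\<Sum>k\<in>{0<..<p}. (\<eta> * inverse \<nu>) ^ k / of_nat k ^ s * (\<Sum>j<k. word_series (y_word ys) $ j / \<eta> ^ j))"
    using 2 \<eta> by (simp add: truncated_czv_Cons)
  also have "\<dots> = (\<Sum>k\<in>{0<..<p}. ?W $ k / \<nu> ^ k)"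
  proof (intro sum.cong refl)
    fix k
    have "(\<eta> * inverse \<nu>) ^ k / of_nat k ^ s * (\<Sum>j<k. word_series (y_word ys) $ j / \<eta> ^ j) =
       (\<Sum>j<k. \<eta> ^ k / \<eta> ^ j * word_series (y_word ys) $ j) / of_nat k ^ s / \<nu> ^ k"
      by (simp add: sum_distrib_left sum_divide_distrib power_mult_distrib field_simps)
    also have "(\<Sum>j<k. \<eta> ^ k / \<eta> ^ j * word_series (y_word ys) $ j) = (\<Sum>j<k. \<eta> ^ (k - j) * word_series (y_word ys) $ j)"
      using \<eta> by (intro sum.cong refl) (simp add: power_diff)
    finally show "(\<eta> * inverse \<nu>) ^ k / of_nat k ^ s * (\<Sum>j<k. word_series (y_word ys) $ j / \<eta> ^ j) = ?W $ k / \<nu> ^ k"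
      by (simp only: W)
  qed
  also have "\<dots> = (\<Sum>k<p. ?W $ k / \<nu> ^ k)"
    by (rule sum.mono_neutral_left) (auto simp: word_series_nth_0)
  finally show ?case .
qed

lemma truncated_czv_q_factors:
  assumes "ys \<in> lists ({1..} \<times> - {0})" "p > 0"
  shows "truncated_czv p (q_factors ys) = word_sum p (y_word ys)"
  unfolding q_factors_eq using truncated_czv_quotient_factors[of ys 1 p] assms by (simp add: word_sum_def)

section \<open>Words at level \<open>N\<close> and their factorisations\<close>

context primitive_root
begin

lemma Gamma_eq: "Gamma N = (\<lambda>k. \<xi> ^ k) ` {..<N}"
  using roots_of_unity_eq by (simp add: Gamma_def)

lemma Gamma_nz: "\<eta> \<in> Gamma N \<Longrightarrow> \<eta> \<noteq> 0"
  using N_pos by (auto simp: Gamma_def power_0_left)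

abbreviation "letters \<equiv> insert 0 (Gamma N)"

lemma y_factors_lists: "w \<in> words1 letters \<Longrightarrow> y_factors N w \<in> lists ({1..} \<times> Gamma N)"
  using bij_betw_y_word[OF N_pos] unfolding y_factors_def by (metis bij_betw_def inv_into_into)

lemma y_word_y_factors: "w \<in> words1 letters \<Longrightarrow> y_word (y_factors N w) = w"
  using bij_betw_y_word[OF N_pos] unfolding y_factors_def by (metis bij_betw_def f_inv_into_f)

lemma y_factors_y_word: "ys \<in> lists ({1..} \<times> Gamma N) \<Longrightarrow> y_factors N (y_word ys) = ys"
  using bij_betw_y_word[OF N_pos] unfolding y_factors_def by (simp add: bij_betw_def inv_into_f_f)

lemma y_word_words1: "ys \<in> lists ({1..} \<times> Gamma N) \<Longrightarrow> y_word ys \<in> words1 letters"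
  using bij_betw_y_word[OF N_pos] by (metis bij_betwE)

lemma q_factors_Gamma:
  assumes "ys \<in> lists ({1..} \<times> Gamma N)"
  shows "q_factors ys \<in> lists ({1..} \<times> Gamma N)"
proof -
  have "quotient_factors \<nu> ys \<in> lists ({1..} \<times> Gamma N)" if "\<nu> \<in> Gamma N" for \<nu>
    using assms that
  proof (induction \<nu> ys rule: quotient_factors.induct)
    case (2 \<nu> s \<eta> ys)
    hence "\<eta> * inverse \<nu> \<in> Gamma N" by (auto simp: Gamma_def power_mult_distrib power_inverse)
    with 2 show ?case by auto
  qed simp
  moreover have "1 \<in> Gamma N" by (simp add: Gamma_def)
  ultimately show ?thesis unfolding q_factors_eq by blast
qed

text \<open>Like \<open>words_alg1 N\<close>, but with coefficients in the explicit
  \<open>rational_span\<close>, whose elements reduce at almost all primes.\<close>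

definition admissible :: "ncpoly set" where
  "admissible = {u. Poly_Mapping.keys u \<subseteq> words1 letters \<and> (\<forall>w. Poly_Mapping.lookup u w \<in> rational_span)}"

lemma admissible_single: "w \<in> words1 letters \<Longrightarrow> Poly_Mapping.single w (of_int n) \<in> admissible"
  by (auto simp: admissible_def lookup_single when_def)

lemma admissible_lin_ext:
  assumes "\<And>w. Poly_Mapping.lookup u w \<in> rational_span"
    "\<And>w. w \<in> Poly_Mapping.keys u \<Longrightarrow> f w \<in> admissible"
  shows "lin_ext f u \<in> admissible"
  using keys_lin_ext[of f u] assms unfolding admissible_def
  by (auto simp: lookup_lin_ext pairing_def intro!: rational_span_sum rational_span_mult)

end

section \<open>Components of the zeta values as reductions of complex sums\<close>

context root_reduction
begin

lemma Gamma_loc: "insert 0 (Gamma N) \<subseteq> loc"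
  by (auto simp: Gamma_eq intro: loc_power loc_root)

text \<open>Reduction is multiplicative and sends \<open>\<xi>\<close> to \<open>x\<close>, so the
  exponent picked by \<open>LEAST\<close> does not matter.\<close>

lemma red_transfer_root:
  assumes "\<eta> \<in> Gamma N"
  shows "transfer_root \<xi> L x \<eta> = red \<eta>"
proof -
  from assms have ex: "\<exists>e. \<xi> ^ e = \<eta>" by (auto simp: Gamma_eq)
  have "red \<eta> = red (\<xi> ^ (LEAST e. \<xi> ^ e = \<eta>))"
    using LeastI_ex[OF ex] by simp
  thus ?thesis by (simp add: transfer_root_def red_power loc_root red_root)
qed

lemma czv_term_loc:
  assumes "\<eta> \<in> Gamma N" "k \<in> {0<..<p}"
  shows "\<eta> ^ k / of_nat k ^ s \<in> loc"
    "red (\<eta> ^ k / of_nat k ^ s) = (transfer_root \<xi> L x \<eta> [^] k) \<otimes> inv ((add_pow L k \<one>) [^] s)"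
proof -
  have \<eta>: "\<eta> \<in> loc" using assms Gamma_loc by blast
  have dvd: "\<not> int p dvd int k ^ s"
    using prime_p assms not_dvd_less[of k] prime_dvd_power[of "int p" "int k" s] by auto
  have e: "embed_int L (int k ^ s) = (add_pow L k \<one>) [^] s"
  proof (induction s)
    case (Suc s)
    then show ?case by (simp add: embed_int_mult embed_int_of_nat m_comm)
  qed simp
  have eq: "\<eta> ^ k / of_nat k ^ s = \<eta> ^ k / of_int (int k ^ s)" by simp
  show "\<eta> ^ k / of_nat k ^ s \<in> loc" unfolding eq using \<eta> dvd by (intro loc_divide loc_power)
  show "red (\<eta> ^ k / of_nat k ^ s) = (transfer_root \<xi> L x \<eta> [^] k) \<otimes> inv ((add_pow L k \<one>) [^] s)"
    unfolding eq red_divide[OF loc_power[OF \<eta>] dvd] e red_transfer_root[OF assms(1)] red_power[OF \<eta>] ..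
qed

lemma zeta_comp_eq:
  assumes "ys \<in> lists ({1..} \<times> Gamma N)"
  shows "zeta_comp \<xi> L x p ys = red (truncated_czv p ys)" and "truncated_czv p ys \<in> loc"
proof -
  have mem: "snd (ys ! j) \<in> Gamma N" if "j < length ys" for j
    using assms nth_mem[OF that] by (auto simp: in_lists_conv_set mem_Times_iff)
  have ks: "ks ! j \<in> {0<..<p}" if "ks \<in> index_lists (length ys) p" "j < length ys" for ks j
    using that nth_mem[of j ks] by (auto simp: index_lists_def subset_iff)
  note term_loc = czv_term_loc[OF mem ks]
  show "truncated_czv p ys \<in> loc"
    unfolding truncated_czv_def by (intro loc_sum loc_prod term_loc(1)) auto
  have "red (truncated_czv p ys) = (\<Oplus>ks\<in>index_lists (length ys) p.
     red (\<Prod>j<length ys. snd (ys ! j) ^ (ks ! j) / of_nat (ks ! j) ^ fst (ys ! j)))"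
    unfolding truncated_czv_def by (intro red_sum loc_prod term_loc(1) finite_index_lists) auto
  also have "\<dots> = (\<Oplus>ks\<in>index_lists (length ys) p. \<Otimes>j\<in>{..<length ys}.
     red (snd (ys ! j) ^ (ks ! j) / of_nat (ks ! j) ^ fst (ys ! j)))"
    by (intro finsum_cong' red_prod term_loc(1)) auto
  also have "\<dots> = zeta_comp \<xi> L x p ys"
    unfolding zeta_comp_def index_lists_def[symmetric]
  proof (intro finsum_cong' finprod_cong' refl)
    show "(\<lambda>ks. \<Otimes>j\<in>{..<length ys}. (transfer_root \<xi> L x (snd (ys ! j)) [^] (ks ! j)) \<otimes>
       inv ((add_pow L (ks ! j) \<one>) [^] fst (ys ! j))) \<in> index_lists (length ys) p \<rightarrow> carrier L"
      using term_loc(2)[symmetric] by (auto intro!: finprod_closed)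
  qed (use term_loc(2) in \<open>auto simp flip: term_loc(2)\<close>)
  finally show "zeta_comp \<xi> L x p ys = red (truncated_czv p ys)" ..
qed

end

section \<open>The shuffle relation\<close>

lemma words1_append: "a \<in> words1 S \<Longrightarrow> b \<in> words1 S \<Longrightarrow> a @ b \<in> words1 S"
  by (auto simp: words1_def last_append)

lemma y_factors_level1:
  assumes "w \<in> words1 {0, 1}"
  shows "y_factors 1 w \<in> lists ({1..} \<times> {1})" "y_word (y_factors 1 w) = w"
proof -
  have 1: "Gamma 1 = {1}" by (auto simp: Gamma_def)
  have "bij_betw y_word (lists ({1..} \<times> {1})) (words1 {0, 1})"
    using bij_betw_y_word[of 1] unfolding 1 by simp
  thus "y_factors 1 w \<in> lists ({1..} \<times> {1})" "y_word (y_factors 1 w) = w"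
    unfolding y_factors_def 1 using assms by (metis bij_betw_def inv_into_into, metis bij_betw_def f_inv_into_f)
qed

text \<open>Kept as an integer so that \<open>admissible_single\<close> and
  \<open>loc_of_int\<close> apply to it.\<close>

definition tau_sign :: "complex list \<Rightarrow> int" where
  "tau_sign a = (-1) ^ sum_list (map fst (y_factors 1 a))"

definition tau_word :: "complex list \<Rightarrow> complex list" where
  "tau_word a = y_word (rev (y_factors 1 a))"

lemma tau_eq: "tau = lin_ext (\<lambda>a. Poly_Mapping.single (tau_word a) (of_int (tau_sign a)))"
  by (simp add: tau_def tau_sign_def tau_word_def Let_def)

section \<open>Values of admissible polynomials and comparison of both sides\<close>

context finite_czv
begin

text \<open>Moves a linear combination inside the class, where it is formed among complex numbers.
  The reduction respects it at all primes where the finitely many coefficients lie in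
  \<open>loc_at p\<close>, and classes ignore the rest.\<close>

lemma czv_finsum:
  assumes "finite W" "W \<subseteq> words1 letters" "\<And>w. c w \<in> rational_span"
  shows "(\<Oplus>\<^bsub>\<A>\<^esub>w\<in>W. A_embed N \<xi> L x (c w) \<otimes>\<^bsub>\<A>\<^esub> zeta_A N \<xi> L x (y_factors N w)) =
     cls (\<lambda>p. red_at p (\<Sum>w\<in>W. c w * truncated_czv p (y_factors N w)))"
  using assms
proof (induction W rule: finite_induct)
  case empty
  interpret A: ring \<A> by (rule ring_A)
  have "cls (\<lambda>p. red_at p 0) = cls (\<lambda>p. \<zero>\<^bsub>L p\<^esub>)"
    unfolding A_class_def using root_reduction.red_0[OF reduction] by (intro arg_cong[where f = "\<lambda>f. _ +>\<^bsub>_\<^esub> f"]) (auto simp: restrict_def fun_eq_iff)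
  then show ?case by (simp add: cls_zero)
next
  case (insert w W)
  interpret A: ring \<A> by (rule ring_A)
  let ?z = "\<lambda>p w. truncated_czv p (y_factors N w)"
  have zeta: "zeta_A N \<xi> L x (y_factors N w) = cls (\<lambda>p. red_at p (?z p w))"
    if "w \<in> words1 letters" for w
    unfolding zeta_A_def A_class_def
    using root_reduction.zeta_comp_eq(1)[OF reduction y_factors_lists[OF that]]
    by (intro arg_cong[where f = "\<lambda>f. _ +>\<^bsub>_\<^esub> f"]) (auto simp: restrict_def fun_eq_iff)
  have summand: "A_embed N \<xi> L x (c w) \<otimes>\<^bsub>\<A>\<^esub> zeta_A N \<xi> L x (y_factors N w) =
      cls (\<lambda>p. red_at p (c w * ?z p w))" if w: "w \<in> words1 letters" for w
  proof -
    have comp: "(\<lambda>p. red_at p (c w) \<otimes>\<^bsub>L p\<^esub> red_at p (?z p w)) \<in> components"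
      using ring.ring_simprules(5)[OF ring_res] red_closed_res by (simp add: components_def)
    have "finite {p \<in> primes_minus1 N. red_at p (c w) \<otimes>\<^bsub>L p\<^esub> red_at p (?z p w) \<noteq> red_at p (c w * ?z p w)}"
      using root_reduction.red_mult[OF reduction] root_reduction.zeta_comp_eq(2)[OF reduction y_factors_lists[OF w]]
      by (intro finite_subset[OF _ loc_cofinite[OF insert.prems(2)[of w]]]) auto
    thus ?thesis unfolding zeta[OF w] A_embed_eq[OF insert.prems(2)] cls_mult[OF red_components red_components]
      by (intro cls_eqI comp red_components)
  qed
  have "(\<Oplus>\<^bsub>\<A>\<^esub>w\<in>insert w W. A_embed N \<xi> L x (c w) \<otimes>\<^bsub>\<A>\<^esub> zeta_A N \<xi> L x (y_factors N w)) =
    cls (\<lambda>p. red_at p (c w * ?z p w)) \<oplus>\<^bsub>\<A>\<^esub> cls (\<lambda>p. red_at p (\<Sum>w\<in>W. c w * ?z p w))"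
    using insert by (subst A.finsum_insert) (auto simp: summand intro!: cls_closed red_components)
  also have "\<dots> = cls (\<lambda>p. red_at p (\<Sum>w\<in>insert w W. c w * ?z p w))"
    unfolding cls_add[OF red_components red_components]
  proof (rule cls_eqI)
    show "(\<lambda>p. red_at p (c w * ?z p w) \<oplus>\<^bsub>L p\<^esub> red_at p (\<Sum>w\<in>W. c w * ?z p w)) \<in> components"
      using ring.ring_simprules(1)[OF ring_res] red_closed_res by (simp add: components_def)
    let ?B = "\<Union>w\<in>insert w W. {p \<in> primes_minus1 N. c w \<notin> loc_at p}"
    have "finite ?B" using insert by (intro finite_UN_I loc_cofinite) auto
    moreover have "red_at p (c w * ?z p w) \<oplus>\<^bsub>L p\<^esub> red_at p (\<Sum>w\<in>W. c w * ?z p w) =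
        red_at p (\<Sum>w\<in>insert w W. c w * ?z p w)" if p: "p \<in> primes_minus1 N" "p \<notin> ?B" for p
    proof -
      interpret root_reduction N \<xi> "L p" p "x p" by (rule reduction) fact
      have "c w' * ?z p w' \<in> loc" if "w' \<in> insert w W" for w'
        using that p insert.prems zeta_comp_eq(2) y_factors_lists by (intro loc_mult) auto
      thus ?thesis using insert by (simp add: red_add loc_sum)
    qed
    ultimately show "finite {p \<in> primes_minus1 N. red_at p (c w * ?z p w) \<oplus>\<^bsub>L p\<^esub> red_at p (\<Sum>w\<in>W. c w * ?z p w)
        \<noteq> red_at p (\<Sum>w\<in>insert w W. c w * ?z p w)}"
      by (elim finite_subset[rotated]) auto
  qed (rule red_components)
  finally show ?case .
qed

text \<open>The quotients of roots introduced by \<open>q_map\<close> are exactly those of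
  \<open>truncated_czv_q_factors\<close>, so each word contributes the partial sum of its
  series.\<close>

lemma zeta_A_shuffle_eq:
  assumes "u \<in> admissible"
  shows "zeta_A_shuffle N \<xi> L x u = cls (\<lambda>p. red_at p (pairing (word_sum p) u))"
proof -
  let ?q = "\<lambda>w. y_word (q_factors (y_factors N w))"
  have q: "q_map N u \<in> admissible"
    unfolding q_map_def
  proof (rule admissible_lin_ext)
    show "Poly_Mapping.single (?q w) 1 \<in> admissible" if "w \<in> Poly_Mapping.keys u" for w
    proof -
      have "w \<in> words1 letters" using that assms by (auto simp: admissible_def)
      hence "?q w \<in> words1 letters" by (intro y_word_words1 q_factors_Gamma y_factors_lists)
      thus ?thesis using admissible_single[of _ 1] by simp
    qed
  qed (use assms in \<open>auto simp: admissible_def\<close>)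
  have "zeta_A_shuffle N \<xi> L x u =
    cls (\<lambda>p. red_at p (pairing (\<lambda>w. truncated_czv p (y_factors N w)) (q_map N u)))"
    unfolding zeta_A_shuffle_def zeta_A_star_def comp_def pairing_def
    using q by (intro czv_finsum) (auto simp: admissible_def)
  also have "\<dots> = cls (\<lambda>p. red_at p (pairing (word_sum p) u))"
  proof (rule cls_eqI)
    have "pairing (\<lambda>w. truncated_czv p (y_factors N w)) (q_map N u) = pairing (word_sum p) u"
      if p: "p \<in> primes_minus1 N" for p
    proof -
      have "pairing (\<lambda>w. truncated_czv p (y_factors N w)) (q_map N u) =
            pairing (\<lambda>w. truncated_czv p (y_factors N (?q w))) u"
        unfolding q_map_def pairing_lin_ext by simp
      also have "\<dots> = pairing (word_sum p) u"
        unfolding pairing_def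
      proof (intro sum.cong refl arg_cong2[of _ _ _ _ "(*)"])
        fix w assume "w \<in> Poly_Mapping.keys u"
        hence w: "w \<in> words1 letters" using assms by (auto simp: admissible_def)
        have "y_factors N w \<in> lists ({1..} \<times> - {0})"
          using y_factors_lists[OF w] Gamma_nz by (auto simp: in_lists_conv_set)
        note this prime_gt_0_nat[OF prime_p[OF p]]
        note truncated_czv_q_factors[OF this]
        thus "truncated_czv p (y_factors N (?q w)) = word_sum p w"
          by (simp only: y_factors_y_word[OF q_factors_Gamma[OF y_factors_lists[OF w]]] y_word_y_factors[OF w])
      qed
      finally show ?thesis .
    qed
    thus "finite {p \<in> primes_minus1 N. red_at p (pairing (\<lambda>w. truncated_czv p (y_factors N w)) (q_map N u)) \<noteq>
        red_at p (pairing (word_sum p) u)}"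
      by (intro finite_subset[OF _ finite.emptyI]) auto
  qed (rule red_components)+
  finally show ?thesis .
qed

lemma words1_level1: "words1 {0, 1} \<subseteq> words1 letters"
  by (auto simp: words1_def Gamma_def)

lemma tau_word_words1: 
  assumes "a \<in> words1 {0, 1}"
  shows "tau_word a \<in> words1 letters"
proof -
  have "rev (y_factors 1 a) \<in> lists ({1..} \<times> Gamma N)"
    using y_factors_level1(1)[OF assms] by (auto simp: in_lists_conv_set Gamma_def)
  thus ?thesis unfolding tau_word_def by (rule y_word_words1)
qed

text \<open>The shuffle becomes a product of series, which \<open>series_product_reverse\<close>
  unwinds factor by factor.\<close>

lemma word_sum_shuffle_tau:
  assumes "p \<in> primes_minus1 N" "a \<in> words1 {0, 1}" "b \<in> words1 letters"
  shows "\<exists>z\<in>loc_at p. pairing (word_sum p) (shuffle_words a b) -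
     of_int (tau_sign a) * word_sum p (tau_word a @ b) = of_nat p * z"
proof -
  interpret root_reduction N \<xi> "L p" p "x p" by (rule reduction) fact
  have "set b \<subseteq> loc" using assms(3) Gamma_loc by (auto simp: words1_def)
  note series_product_reverse[OF y_factors_level1(1)[OF assms(2)] this]
  moreover have "pairing (word_sum p) (shuffle_words a b) =
     (\<Sum>n<p. (word_series (y_word (y_factors 1 a)) * word_series b) $ n)"
    unfolding y_factors_level1(2)[OF assms(2)]
    using assms(2,3) by (intro word_sum_shuffle) (auto simp: words1_def)
  ultimately show ?thesis by (simp only: tau_sign_def tau_word_def of_int_power of_int_minus of_int_1)
qed

text \<open>The congruences for pairs of words are summed with coefficients; where all products of
  coefficients lie in \<open>loc_at p\<close>, the total difference is \<open>p\<close> times an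
  element of it and reduces to zero.\<close>

lemma shuffle_tau:
  assumes "u \<in> words_alg1_level1 N" "v \<in> words_alg1 N"
  shows "zeta_A_shuffle N \<xi> L x (shuffle u v) = zeta_A_shuffle N \<xi> L x (conc (tau u) v)"
proof -
  have u: "Poly_Mapping.keys u \<subseteq> words1 {0, 1}" "\<And>w. Poly_Mapping.lookup u w \<in> rational_span"
    and v: "Poly_Mapping.keys v \<subseteq> words1 letters" "\<And>w. Poly_Mapping.lookup v w \<in> rational_span"
    using assms cyclotomic_field_subset by (auto simp: words_alg1_level1_def words_alg1_def word_span_def)
  have "shuffle_words a b \<in> admissible" if "a \<in> words1 letters" "b \<in> words1 letters" for a b
    using lookup_shuffle_words_Ints[of a b] keys_shuffle_words[OF _ that] unfolding admissible_def
    by (auto elim!: Ints_cases) (metis Ints_cases rational_span_of_int)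
  hence adm1: "shuffle u v \<in> admissible"
    unfolding shuffle_def bilin_ext_def using u(1) v(1) words1_level1
    by (intro admissible_lin_ext u(2) v(2)) blast
  have tau: "tau u \<in> admissible"
    unfolding tau_eq using u tau_word_words1 by (intro admissible_lin_ext admissible_single) auto
  hence adm2: "conc (tau u) v \<in> admissible"
    unfolding conc_def bilin_ext_def
  proof (intro admissible_lin_ext v(2))
    show "Poly_Mapping.lookup (tau u) w \<in> rational_span" for w
      using tau by (simp add: admissible_def)
    show "Poly_Mapping.single (a @ b) 1 \<in> admissible"
      if "a \<in> Poly_Mapping.keys (tau u)" "b \<in> Poly_Mapping.keys v" for a b
    proof -
      have "a @ b \<in> words1 letters"
        using that tau v(1) by (intro words1_append) (auto simp: admissible_def)
      thus ?thesis using admissible_single[of "a @ b" 1] by simp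
    qed
  qed
  let ?U = "Poly_Mapping.keys u" and ?V = "Poly_Mapping.keys v"
  let ?c = "\<lambda>a b. Poly_Mapping.lookup u a * Poly_Mapping.lookup v b"
  let ?B = "\<Union>a\<in>?U. \<Union>b\<in>?V. {p \<in> primes_minus1 N. ?c a b \<notin> loc_at p}"
  have fin: "finite ?B" using u v by (intro finite_UN_I loc_cofinite rational_span_mult) auto
  have eq: "red_at p (pairing (word_sum p) (shuffle u v)) = red_at p (pairing (word_sum p) (conc (tau u) v))"
    if p: "p \<in> primes_minus1 N" "p \<notin> ?B" for p
  proof -
    interpret root_reduction N \<xi> "L p" p "x p" by (rule reduction) fact
    obtain z where z: "\<And>a b. a \<in> ?U \<Longrightarrow> b \<in> ?V \<Longrightarrow> z a b \<in> loc \<and>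
       pairing (word_sum p) (shuffle_words a b) -
         of_int (tau_sign a) * word_sum p (tau_word a @ b) = of_nat p * z a b"
      using word_sum_shuffle_tau[OF p(1)] u(1) v(1) by (metis subsetD)
    have "pairing (word_sum p) (shuffle u v) - pairing (word_sum p) (conc (tau u) v) =
       (\<Sum>a\<in>?U. \<Sum>b\<in>?V. ?c a b * (pairing (word_sum p) (shuffle_words a b) -
         of_int (tau_sign a) * word_sum p (tau_word a @ b)))"
      unfolding shuffle_def bilin_ext_def pairing_conc tau_eq pairing_lin_ext
      by (simp add: pairing_def[of _ u] pairing_def[of _ v] sum_distrib_left right_diff_distrib sum_subtractf mult_ac)
    also have "\<dots> = of_nat p * (\<Sum>a\<in>?U. \<Sum>b\<in>?V. ?c a b * z a b)"
      unfolding sum_distrib_left using z by (intro sum.cong refl) (simp add: mult_ac)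
    finally have diff: "pairing (word_sum p) (shuffle u v) = pairing (word_sum p) (conc (tau u) v) +
       of_nat p * (\<Sum>a\<in>?U. \<Sum>b\<in>?V. ?c a b * z a b)" by (simp only: diff_eq_eq add.commute)
    have Z: "(\<Sum>a\<in>?U. \<Sum>b\<in>?V. ?c a b * z a b) \<in> loc"
      using p z by (intro loc_sum loc_mult[of "?c _ _"]) auto
    \<comment> \<open>Additivity of \<open>red\<close> requires this summand to lie in
      \<open>loc\<close>, not just the difference.\<close>
    have "pairing (word_sum p) (conc (tau u) v) \<in> loc"
      unfolding tau_eq pairing_conc pairing_lin_ext pairing_single
    proof -
      have "pairing (\<lambda>w. of_int (tau_sign w) * pairing (\<lambda>b. word_sum p (tau_word w @ b)) v) u =
        (\<Sum>a\<in>?U. \<Sum>b\<in>?V. ?c a b * (of_int (tau_sign a) * word_sum p (tau_word a @ b)))"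
        by (simp add: pairing_def[of _ u] pairing_def[of _ v] sum_distrib_left mult_ac)
      moreover have "?c a b * (of_int (tau_sign a) * word_sum p (tau_word a @ b)) \<in> loc"
        if ab: "a \<in> ?U" "b \<in> ?V" for a b
      proof -
        have "tau_word a \<in> words1 letters" "b \<in> words1 letters"
          using ab u(1) v(1) tau_word_words1[of a] by auto
        hence "word_sum p (tau_word a @ b) \<in> loc"
          using Gamma_loc by (intro word_sum_loc) (auto simp: words1_def)
        hence "of_int (tau_sign a) * word_sum p (tau_word a @ b) \<in> loc"
          by (rule loc_mult[OF loc_of_int])
        moreover have "?c a b \<in> loc" using ab p by blast
        ultimately show ?thesis by (rule loc_mult[rotated])
      qed
      ultimately show "pairing (\<lambda>w. of_int (tau_sign w) * pairing (\<lambda>b. word_sum p (tau_word w @ b)) v) u \<in> loc"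
        by (simp only:) (intro loc_sum)
    qed
    thus ?thesis unfolding diff using Z loc_mult[OF loc_of_int[of "int p"] Z]
      by (simp add: red_add red_multiple_p)
  qed
  have "{p \<in> primes_minus1 N. red_at p (pairing (word_sum p) (shuffle u v)) \<noteq>
      red_at p (pairing (word_sum p) (conc (tau u) v))} \<subseteq> ?B"
    using eq by blast
  hence "finite {p \<in> primes_minus1 N. red_at p (pairing (word_sum p) (shuffle u v)) \<noteq>
      red_at p (pairing (word_sum p) (conc (tau u) v))}"
    using fin by (rule finite_subset)
  thus ?thesis unfolding zeta_A_shuffle_eq[OF adm1] zeta_A_shuffle_eq[OF adm2]
    by (intro cls_eqI red_components)
qed

end

theorem theorem3p3:
  fixes N :: nat and \<xi> :: complex and L :: "nat \<Rightarrow> 'a ring" and x :: "nat \<Rightarrow> 'a"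
    and u v :: ncpoly
  assumes "N \<ge> 1"
    and "primitive_unity_root complex_ring N \<xi>"
    and "\<And>p. p \<in> primes_minus1 N \<Longrightarrow> alg_closure_of_prime_field p (L p)"
    and "\<And>p. p \<in> primes_minus1 N \<Longrightarrow> primitive_unity_root (L p) N (x p)"
    and "u \<in> words_alg1_level1 N"
    and "v \<in> words_alg1 N"
  shows "zeta_A_shuffle N \<xi> L x (shuffle u v) = zeta_A_shuffle N \<xi> L x (conc (tau u) v)"
proof -
  \<comment> \<open>Translates primitivity in \<open>complex_ring\<close> into ordinary powers, as
    the locale expects.\<close>
  have pow: "\<xi> [^]\<^bsub>complex_ring\<^esub> n = \<xi> ^ n" for n :: nat
    by (induction n) (simp_all add: ring_of_type_algebra_def nat_pow_def)
  have one: "\<one>\<^bsub>complex_ring\<^esub> = (1 :: complex)" by (simp add: ring_of_type_algebra_def)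
  interpret finite_czv N \<xi> L x
    using assms(1-4) unfolding primitive_unity_root_def[of complex_ring] pow one
    by unfold_locales auto
  show ?thesis using assms(5,6) by (rule shuffle_tau)
qed

end
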